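(* Let $G=\{V,E\}$, $V=\{1,\dots,N\}$, be a connected undirected graph. For each $i\in V$ let $f_i,g_i:\mathbb{R}^M\to(-\infty,+\infty]$ be proper, convex and closed, with $f_i$ differentiable and $\sigma_i$-strongly convex, $\sigma_i>0$; let $X_i\subseteq\mathbb{R}^M$ be non-empty, convex and closed, and suppose there is $\breve{\mathbf{x}}\in\mathbf{relint}\,X$, $X=X_1\times\cdots\times X_N$, with $\mathbf{A}\breve{\mathbf{x}}=\mathbf{b}$. Let $P,Q,\Phi=P+Q,\mathbf{M},\mathcal{L}$, the set $C$ of saddle points of $\mathcal{L}$, and $h=\max_{i\in V}h_i$ with $h_i=\|\mathbf{H}_i\|^2/\sigma_i$ be as defined in the context. Let the step sizes $c,\gamma>0$ satisfy $$c^{-1}\ \ge\ h+\gamma\,\overline{\tau}(\mathbf{M}^{\top}\mathbf{M}),$$ and let $\{(\bm{\lambda}^t,\bm{\xi}^t)\}_{t\in\mathbb{N}}$ be generated from any initialization $(\bm{\lambda}^0,\bm{\xi}^0)$ by the DDPG algorithm $$\bm{\lambda}^{t+1}=\mathrm{prox}^{c}_{Q}\big[\bm{\lambda}^t-c(\nabla P(\bm{\lambda}^t)+\mathbf{M}^{\top}\bm{\xi}^t+\gamma\mathbf{M}^{\top}\mathbf{M}\bm{\lambda}^t)\big],\qquad \bm{\xi}^{t+1}=\bm{\xi}^t+\gamma\mathbf{M}\bm{\lambda}^{t+1}.$$ For $T\in\mathbb{N}_+$ set $\overline{\bm{\lambda}}^{T+1}=\frac{1}{T+1}\sum_{t=0}^{T}\bm{\lambda}^{t+1}$.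 Then for any given $(\bm{\lambda}^*,\bm{\xi}^* )\in C$, $$|\Phi(\overline{\bm{\lambda}}^{T+1})-\Phi(\bm{\lambda}^* )|\le\mathcal{O}\left(\tfrac1T\right)\quad\text{and}\quad \|\bm{\xi}^*\|\,\|\mathbf{M}\overline{\bm{\lambda}}^{T+1}\|\le\mathcal{O}\left(\tfrac1T\right),$$ i.e. there is a constant $\Theta\ge 0$ independent of $T$ such that both left-hand sides are at most $\Theta/T$ for all $T\in\mathbb{N}_+$.
   Context: Primal problem: $\min_{\mathbf{x}\in X}\sum_{i\in V}(f_i(\mathbf{x}_i)+g_i(\mathbf{x}_i))$ s.t. $\mathbf{A}\mathbf{x}=\mathbf{b}$, with $\mathbf{x}=[\mathbf{x}_1^\top,\dots,\mathbf{x}_N^\top]^\top\in\mathbb{R}^{NM}$, $\mathbf{A}=[\mathbf{A}_1,\dots,\mathbf{A}_N]\in\mathbb{R}^{B\times NM}$, $\mathbf{A}_i\in\mathbb{R}^{B\times M}$, $\mathbf{b}\in\mathbb{R}^B$. $\mathbb{I}_{X_i}$ is the indicator function of $X_i$ ($0$ on $X_i$, $+\infty$ elsewhere); $g_i+\mathbb{I}_{X_i}$ is taken to be proper. Graph: edges are unordered pairs $(i,j)$ with $i\neq j$ (no self-loops), numbered $e_1,\dots,e_{|E|}$ in lexicographic order of (smaller endpoint, larger endpoint). The incidence matrix $\mathbf{Q}\in\mathbb{R}^{N\times|E|}$ has $[\mathbf{Q}]_{jk}=1$ if $e_k=(j,l)$ with $j<l$, $-1$ if $e_k=(j,l)$ with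 $j>l$, and $0$ otherwise. Notation: $\psi^{\diamond}(\mathbf{v})=\sup_{\mathbf{u}}\{\mathbf{v}^\top\mathbf{u}-\psi(\mathbf{u})\}$ is the Fenchel conjugate; $\mathrm{prox}^{\alpha}_{\psi}[\mathbf{v}]=\arg\min_{\mathbf{u}}(\psi(\mathbf{u})+\frac{1}{2\alpha}\|\mathbf{u}-\mathbf{v}\|^2)$; $\overline{\tau}(\cdot)$ is the largest eigenvalue; $\otimes$ is the Kronecker product; $\|\cdot\|$ is the Euclidean norm for vectors and the spectral norm for matrices; $\mathbf{relint}$ is the relative interior; $\mathbb{N}_+$ is the set of positive integers. Dual objects: $\mathbf{H}_i=[-\mathbf{A}_i^\top,-\mathbf{I}_M]\in\mathbb{R}^{M\times(M+B)}$, $\mathbf{F}=[\mathbf{O}_{M\times B},\mathbf{I}_M]$, $\mathbf{E}=[\mathbf{b}^\top,\mathbf{0}_M^\top]\in\mathbb{R}^{1\times(M+B)}$, $\mathbf{K}=[\mathbf{I}_B,\mathbf{O}_{B\times M}]$, and real numbers $\kappa_i$ with $\sum_{i\in V}\kappa_i=1$. The variable is $\bm{\lambda}=[\bm{\lambda}_1^\top,\dots,\bm{\lambda}_N^\top]^\top$, $\bm{\lambda}_i=[\bm{\theta}_i^\top,\bm{\mu}_i^\top]^\top\in\mathbb{R}^{B+M}$ with $\bm{\theta}_i\in\mathbb{R}^B$, $\bm{\mu}_i\in\mathbb{R}^M$. Put $p_i(\bm{\lambda}_i)=f_i^{\diamond}(\mathbf{H}_i\bm{\lambda}_i)+\kappa_i\mathbf{E}\bm{\lambda}_i$,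 $q_i(\bm{\lambda}_i)=(g_i+\mathbb{I}_{X_i})^{\diamond}(\mathbf{F}\bm{\lambda}_i)$, $P(\bm{\lambda})=\sum_i p_i(\bm{\lambda}_i)$, $Q(\bm{\lambda})=\sum_i q_i(\bm{\lambda}_i)$ (the function $Q$ is distinct from the matrix $\mathbf{Q}$), $\Phi=P+Q$, and $\mathbf{M}=\mathbf{Q}^\top\otimes\mathbf{K}$ (the matrix $\mathbf{M}$ is distinct from the dimension $M$); $\mathbf{M}\bm{\lambda}=\mathbf{0}$ encodes $\mathbf{K}\bm{\lambda}_i=\mathbf{K}\bm{\lambda}_j$ for all $(i,j)\in E$. Lagrangian (of the problem $\min_{\bm{\lambda}}\Phi(\bm{\lambda})$ s.t. $\mathbf{M}\bm{\lambda}=\mathbf{0}$): $\mathcal{L}(\bm{\lambda},\bm{\xi})=P(\bm{\lambda})+Q(\bm{\lambda})+\bm{\xi}^\top\mathbf{M}\bm{\lambda}$, $\bm{\xi}\in\mathbb{R}^{|E|B}$. $C$ is the set of its saddle points, i.e. pairs $(\bm{\lambda}^*,\bm{\xi}^* )$ with $\mathcal{L}(\bm{\lambda},\bm{\xi}^* )\ge\mathcal{L}(\bm{\lambda}^*,\bm{\xi}^* )\ge\mathcal{L}(\bm{\lambda}^*,\bm{\xi})$ for all $\bm{\lambda},\bm{\xi}$; equivalently $\mathbf{0}\in\nabla P(\bm{\lambda}^* )+\partial Q(\bm{\lambda}^* )+\mathbf{M}^\top\bm{\xi}^*$ and $\mathbf{M}\bm{\lambda}^*=\mathbf{0}$. 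*)

theory Defs
  imports "HOL-Analysis.Analysis"
begin

section \<open>Extended-real convex analysis\<close>

definition proper_fun :: "('a \<Rightarrow> ereal) \<Rightarrow> bool" where
  "proper_fun f \<longleftrightarrow> (\<forall>x. f x \<noteq> -\<infinity>) \<and> (\<exists>x. f x \<noteq> \<infinity>)"

definition epi :: "('a \<Rightarrow> ereal) \<Rightarrow> ('a \<times> real) set" where
  "epi f = {(x, r). f x \<le> ereal r}"

definition convex_fun :: "('a::real_vector \<Rightarrow> ereal) \<Rightarrow> bool" where
  "convex_fun f \<longleftrightarrow> convex (epi f)"

definition closed_fun :: "('a::topological_space \<Rightarrow> ereal) \<Rightarrow> bool" where
  "closed_fun f \<longleftrightarrow> closed (epi f)"

definition strongly_convex_fun :: "real \<Rightarrow> ('a::real_normed_vector \<Rightarrow> ereal) \<Rightarrow> bool" where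
  "strongly_convex_fun \<sigma> f \<longleftrightarrow>
     (\<forall>x y \<theta>. 0 < \<theta> \<and> \<theta> < 1 \<longrightarrow>
        f ((1 - \<theta>) *\<^sub>R x + \<theta> *\<^sub>R y) + ereal (\<sigma> / 2 * \<theta> * (1 - \<theta>) * (norm (x - y))\<^sup>2)
          \<le> ereal (1 - \<theta>) * f x + ereal \<theta> * f y)"

text \<open>Differentiability of an extended-real function at a point includes finiteness in a
  neighbourhood of that point.\<close>

definition has_gradient :: "('a::real_inner \<Rightarrow> ereal) \<Rightarrow> 'a \<Rightarrow> 'a \<Rightarrow> bool" where
  "has_gradient f g x \<longleftrightarrow>
     (\<forall>\<^sub>F y in nhds x. \<bar>f y\<bar> \<noteq> \<infinity>) \<and> GDERIV (\<lambda>y. real_of_ereal (f y)) x :> g"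

definition gradient :: "('a::real_inner \<Rightarrow> ereal) \<Rightarrow> 'a \<Rightarrow> 'a" where
  "gradient f x = (THE g. has_gradient f g x)"

text \<open>Differentiability is required on the effective domain only; for a real-valued function this
  is differentiability everywhere.\<close>

definition differentiable_fun :: "('a::real_inner \<Rightarrow> ereal) \<Rightarrow> bool" where
  "differentiable_fun f \<longleftrightarrow> (\<forall>x. f x < \<infinity> \<longrightarrow> (\<exists>g. has_gradient f g x))"

definition indicator_fun :: "'a set \<Rightarrow> 'a \<Rightarrow> ereal" where
  "indicator_fun S x = (if x \<in> S then 0 else \<infinity>)"

definition conjugate :: "('a::real_inner \<Rightarrow> ereal) \<Rightarrow> 'a \<Rightarrow> ereal" where
  "conjugate \<psi> v = (SUP u. ereal (v \<bullet> u) - \<psi> u)"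

definition prox :: "real \<Rightarrow> ('a::real_normed_vector \<Rightarrow> ereal) \<Rightarrow> 'a \<Rightarrow> 'a" where
  "prox \<alpha> \<psi> v = (ARG_MIN (\<lambda>u. \<psi> u + ereal (1 / (2 * \<alpha>) * (norm (u - v))\<^sup>2)) u. True)"

section \<open>Matrices\<close>

text \<open>Square matrices; for symmetric ones the set of eigenvalues is finite and non-empty.\<close>

definition max_eigenvalue :: "real^'k^'k \<Rightarrow> real" where
  "max_eigenvalue S = Max {\<tau>. \<exists>v. v \<noteq> 0 \<and> S *v v = \<tau> *\<^sub>R v}"

definition spectral_norm :: "real^'k^'l \<Rightarrow> real" where
  "spectral_norm S = onorm ((*v) S)"

text \<open>The number of edges depends on the graph and is zero for a single vertex, so
  the edge index cannot be a type. Matrices and vectors indexed by edges are functions,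
  of which only the entries with row index in a given finite set \<open>R\<close> are meaningful.\<close>

definition mat_app :: "('r \<Rightarrow> 'c \<Rightarrow> real) \<Rightarrow> real^'c \<Rightarrow> 'r \<Rightarrow> real" where
  "mat_app S v = (\<lambda>r. \<Sum>c\<in>UNIV. S r c * v $ c)"

definition transpose_app :: "'r set \<Rightarrow> ('r \<Rightarrow> 'c \<Rightarrow> real) \<Rightarrow> ('r \<Rightarrow> real) \<Rightarrow> real^'c" where
  "transpose_app R S w = (\<chi> c. \<Sum>r\<in>R. S r c * w r)"

text \<open>\<open>gram R S\<close> is the transpose of \<open>S\<close> times \<open>S\<close>.\<close>

definition gram :: "'r set \<Rightarrow> ('r \<Rightarrow> 'c \<Rightarrow> real) \<Rightarrow> real^'c^'c" where
  "gram R S = (\<chi> c d. \<Sum>r\<in>R. S r c * S r d)"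

definition inner_on :: "'r set \<Rightarrow> ('r \<Rightarrow> real) \<Rightarrow> ('r \<Rightarrow> real) \<Rightarrow> real" where
  "inner_on R v w = (\<Sum>r\<in>R. v r * w r)"

definition norm_on :: "'r set \<Rightarrow> ('r \<Rightarrow> real) \<Rightarrow> real" where
  "norm_on R v = L2_set v R"

definition kronecker ::
    "('r \<Rightarrow> 'c \<Rightarrow> real) \<Rightarrow> ('s \<Rightarrow> 'd \<Rightarrow> real) \<Rightarrow> 'r \<times> 's \<Rightarrow> 'c \<times> 'd \<Rightarrow> real" where
  "kronecker S T = (\<lambda>(r, s) (c, d). S r c * T s d)"

section \<open>Graphs\<close>

text \<open>The vertex set is the linearly ordered finite type \<open>'n\<close>, i.e. \<open>{1,\<dots>,N}\<close> up to renaming.\<close>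

definition undirected_graph :: "'n set set \<Rightarrow> bool" where
  "undirected_graph E \<longleftrightarrow> (\<forall>e\<in>E. \<exists>i j. i \<noteq> j \<and> e = {i, j})"

definition connected_graph :: "'n set set \<Rightarrow> bool" where
  "connected_graph E \<longleftrightarrow> (\<forall>i j. (i, j) \<in> {(u, v). {u, v} \<in> E}\<^sup>*)"

text \<open>The comprehension enumerates the edges lexicographically by (smaller, larger endpoint).
  Edge numbers start at \<open>0\<close>.\<close>

definition edge_list :: "'n::{finite,linorder} set set \<Rightarrow> 'n set list" where
  "edge_list E = [{i, j}. i \<leftarrow> sorted_list_of_set UNIV, j \<leftarrow> sorted_list_of_set UNIV,
                          i < j \<and> {i, j} \<in> E]"

definition incidence :: "'n::{finite,linorder} set set \<Rightarrow> 'n \<Rightarrow> nat \<Rightarrow> real" where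
  "incidence E j k =
     (if k < card E \<and> (\<exists>l. j < l \<and> edge_list E ! k = {j, l}) then 1
      else if k < card E \<and> (\<exists>l. j > l \<and> edge_list E ! k = {j, l}) then -1
      else 0)"

section \<open>The primal and the dual problem\<close>

text \<open>Stacked vectors are indexed by pairs (vertex, component).\<close>

definition blk :: "'n::finite \<Rightarrow> real^('n \<times> 'd::finite) \<Rightarrow> real^'d" where
  "blk i x = (\<chi> r. x $ (i, r))"

definition product_set :: "('n::finite \<Rightarrow> (real^('d::finite)) set) \<Rightarrow> (real^('n \<times> 'd)) set" where
  "product_set X = {x. \<forall>i. blk i x \<in> X i}"

definition block_row :: "('n::finite \<Rightarrow> real^('m::finite)^('b::finite)) \<Rightarrow> real^('n \<times> 'm)^'b" where
  "block_row A = (\<chi> r c. A (fst c) $ r $ snd c)"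

text \<open>Vectors \<open>[\<theta>, \<mu>]\<close> with \<open>\<theta>\<close> in \<open>real^'b\<close> and \<open>\<mu>\<close> in \<open>real^'m\<close> are indexed by \<open>'b + 'm\<close>.\<close>

definition H_mat :: "real^('m::finite)^('b::finite) \<Rightarrow> real^('b + 'm)^'m" where
  "H_mat A = (\<chi> r c. case c of Inl s \<Rightarrow> - (transpose A $ r $ s) | Inr s \<Rightarrow> - (mat 1 $ r $ s))"

definition F_mat :: "real^(('b::finite) + ('m::finite))^'m" where
  "F_mat = (\<chi> r c. case c of Inl s \<Rightarrow> 0 | Inr s \<Rightarrow> mat 1 $ r $ s)"

text \<open>The row vector \<open>[b, 0]\<close>, applied by the inner product.\<close>

definition E_vec :: "real^('b::finite) \<Rightarrow> real^('b + ('m::finite))" where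
  "E_vec b = (\<chi> c. case c of Inl s \<Rightarrow> b $ s | Inr s \<Rightarrow> 0)"

definition K_mat :: "real^(('b::finite) + ('m::finite))^'b" where
  "K_mat = (\<chi> r c. case c of Inl s \<Rightarrow> mat 1 $ r $ s | Inr s \<Rightarrow> 0)"

definition p_fun :: "(real^('m::finite) \<Rightarrow> ereal) \<Rightarrow> real^'m^('b::finite) \<Rightarrow> real^'b \<Rightarrow> real \<Rightarrow> real^('b + 'm) \<Rightarrow> ereal" where
  "p_fun f A b \<kappa> l = conjugate f (H_mat A *v l) + ereal (\<kappa> * (E_vec b \<bullet> l))"

definition q_fun :: "(real^('m::finite) \<Rightarrow> ereal) \<Rightarrow> (real^'m) set \<Rightarrow> real^(('b::finite) + 'm) \<Rightarrow> ereal" where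
  "q_fun g X l = conjugate (\<lambda>x. g x + indicator_fun X x) (F_mat *v l)"

definition P_fun :: "('n::finite \<Rightarrow> real^('m::finite) \<Rightarrow> ereal) \<Rightarrow> ('n \<Rightarrow> real^'m^('b::finite)) \<Rightarrow> real^'b \<Rightarrow> ('n \<Rightarrow> real)
    \<Rightarrow> real^('n \<times> ('b + 'm)) \<Rightarrow> ereal" where
  "P_fun f A b \<kappa> l = (\<Sum>i\<in>UNIV. p_fun (f i) (A i) b (\<kappa> i) (blk i l))"

definition Q_fun :: "('n::finite \<Rightarrow> real^('m::finite) \<Rightarrow> ereal) \<Rightarrow> ('n \<Rightarrow> (real^'m) set)
    \<Rightarrow> real^('n \<times> (('b::finite) + 'm)) \<Rightarrow> ereal" where
  "Q_fun g X l = (\<Sum>i\<in>UNIV. q_fun (g i) (X i) (blk i l))"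

text \<open>The matrix \<open>\<^bold>M\<close> (transposed incidence matrix, Kronecker product with \<open>K\<close>) and its set of
  row indices (edge number, component).\<close>

definition M_mat :: "'n::{finite,linorder} set set \<Rightarrow> nat \<times> ('b::finite) \<Rightarrow> 'n \<times> ('b + ('m::finite)) \<Rightarrow> real" where
  "M_mat E = kronecker (\<lambda>k j. incidence E j k) (\<lambda>r c. (K_mat :: real^('b + 'm)^'b) $ r $ c)"

definition M_rows :: "'n set set \<Rightarrow> (nat \<times> ('b::finite)) set" where
  "M_rows E = {..<card E} \<times> UNIV"

definition lagrangian ::
    "'n::{finite,linorder} set set \<Rightarrow> (real^('n \<times> (('b::finite) + ('m::finite))) \<Rightarrow> ereal)
      \<Rightarrow> (real^('n \<times> ('b + 'm)) \<Rightarrow> ereal)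
      \<Rightarrow> real^('n \<times> ('b + 'm)) \<Rightarrow> (nat \<times> 'b \<Rightarrow> real) \<Rightarrow> ereal" where
  "lagrangian E P Q l \<xi> = P l + Q l + ereal (inner_on (M_rows E) \<xi> (mat_app (M_mat E) l))"

definition saddle_points ::
    "('l \<Rightarrow> 'x \<Rightarrow> ereal) \<Rightarrow> ('l \<times> 'x) set" where
  "saddle_points L = {(l', \<xi>'). \<forall>l \<xi>. L l \<xi>' \<ge> L l' \<xi>' \<and> L l' \<xi>' \<ge> L l' \<xi>}"

end

theory Submission
  imports Defs
begin

text \<open>
  Strong convexity of \<open>f\<^sub>i\<close> makes its conjugate finite and smooth with constant \<open>1 / \<sigma>\<^sub>i\<close>, so \<open>P\<close> is
  sandwiched between its linearisation and the linearisation plus \<open>h / 2\<close> times the squared distance.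
  Together with the variational inequality of the proximal step this gives, for every \<open>\<xi>\<close>,
  a bound of \<open>\<Phi> \<lambda>\<^sup>t\<^sup>+\<^sup>1 - \<Phi> \<lambda>\<^sup>* + \<xi> \<bullet> M \<lambda>\<^sup>t\<^sup>+\<^sup>1\<close> by the decrease of the energy
  \<open>D (\<lambda>\<^sup>t - \<lambda>\<^sup>*) / 2 + norm (\<xi>\<^sup>t - \<xi>)\<^sup>2 / (2 * \<gamma>)\<close>, where the step size rule makes the quadratic form
  \<open>D v = norm v\<^sup>2 / c - \<gamma> * norm (M v)\<^sup>2\<close> at least \<open>h * norm v\<^sup>2\<close>. Telescoping and Jensen's inequality
  bound \<open>\<Phi> avg - \<Phi> \<lambda>\<^sup>* + \<xi> \<bullet> M avg\<close> by a multiple of \<open>1 / T\<close>, uniformly over \<open>norm \<xi> \<le> norm \<xi>\<^sup>* + 1\<close>.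
  The choice of \<open>\<xi>\<close> parallel to \<open>M avg\<close> and the saddle point inequality separate the two terms.
\<close>

section \<open>Minimisers of strongly convex functions\<close>

lemma epi_iff [simp]: "(x, r) \<in> epi f \<longleftrightarrow> f x \<le> ereal r"
  by (simp add: epi_def)

text \<open>Modulus 0 is plain convexity written as an inequality, so convex and strongly convex
  functions can be added by one lemma.\<close>

lemma convex_fun_imp_strongly_convex_0:
  assumes "convex_fun f" and "\<And>x. f x \<noteq> -\<infinity>"
  shows "strongly_convex_fun 0 f"
  unfolding strongly_convex_fun_def
proof (intro allI impI)
  fix x y and \<theta> :: real
  assume \<theta>: "0 < \<theta> \<and> \<theta> < 1"
  show "f ((1 - \<theta>) *\<^sub>R x + \<theta> *\<^sub>R y) + ereal (0 / 2 * \<theta> * (1 - \<theta>) * (norm (x - y))\<^sup>2)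
          \<le> ereal (1 - \<theta>) * f x + ereal \<theta> * f y"
  proof (cases "f x = \<infinity> \<or> f y = \<infinity>")
    case True
    then show ?thesis
      using \<theta> assms(2)[of x] assms(2)[of y] by (cases "f x"; cases "f y") auto
  next
    case False
    then obtain a b where ab: "f x = ereal a" "f y = ereal b"
      using assms(2) by (metis ereal_cases)
    have "(1 - \<theta>) *\<^sub>R (x, a) + \<theta> *\<^sub>R (y, b) \<in> epi f"
      using assms(1)[unfolded convex_fun_def convex_alt, rule_format, of "(x, a)" "(y, b)" \<theta>] \<theta> ab
      by simp
    then show ?thesis
      by (simp add: ab)
  qed
qed

lemma strongly_convex_imp_convex_fun:
  assumes f: "strongly_convex_fun \<sigma> f" and "\<sigma> \<ge> 0"
  shows "convex_fun f"
  unfolding convex_fun_def convex_alt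
proof (intro ballI allI impI)
  fix u v :: "'a \<times> real" and \<theta> :: real
  assume uv: "u \<in> epi f" "v \<in> epi f" and \<theta>: "0 \<le> \<theta> \<and> \<theta> \<le> 1"
  obtain x a y b where xy: "u = (x, a)" "v = (y, b)" by fastforce
  have le: "f x \<le> ereal a" "f y \<le> ereal b" using uv xy by auto
  show "(1 - \<theta>) *\<^sub>R u + \<theta> *\<^sub>R v \<in> epi f"
  proof (cases "\<theta> = 0 \<or> \<theta> = 1")
    case True
    then show ?thesis using uv by auto
  next
    case False
    then have \<theta>: "0 < \<theta>" "\<theta> < 1" using \<theta> by auto
    have "f ((1 - \<theta>) *\<^sub>R x + \<theta> *\<^sub>R y) + 0 \<le>
        f ((1 - \<theta>) *\<^sub>R x + \<theta> *\<^sub>R y) + ereal (\<sigma> / 2 * \<theta> * (1 - \<theta>) * (norm (x - y))\<^sup>2)"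
      using \<theta> assms(2) by (intro add_left_mono) auto
    also have "\<dots> \<le> ereal (1 - \<theta>) * f x + ereal \<theta> * f y"
      using f \<theta> unfolding strongly_convex_fun_def by blast
    also have "\<dots> \<le> ereal (1 - \<theta>) * ereal a + ereal \<theta> * ereal b"
      using \<theta> le by (intro add_mono ereal_mult_left_mono) auto
    finally show ?thesis by (simp add: xy)
  qed
qed

lemma strongly_convex_fun_add:
  fixes f g :: "'a::real_normed_vector \<Rightarrow> ereal"
  assumes f: "strongly_convex_fun s f" and g: "strongly_convex_fun r g"
    and fin: "\<And>x. f x \<noteq> -\<infinity>" "\<And>x. g x \<noteq> -\<infinity>"
  shows "strongly_convex_fun (s + r) (\<lambda>x. f x + g x)"
  unfolding strongly_convex_fun_def
proof (intro allI impI)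
  fix x y :: 'a and \<theta> :: real
  assume \<theta>: "0 < \<theta> \<and> \<theta> < 1"
  let ?z = "(1 - \<theta>) *\<^sub>R x + \<theta> *\<^sub>R y"
  have "f ?z + g ?z + ereal ((s + r) / 2 * \<theta> * (1 - \<theta>) * (norm (x - y))\<^sup>2) =
      (f ?z + ereal (s / 2 * \<theta> * (1 - \<theta>) * (norm (x - y))\<^sup>2)) +
      (g ?z + ereal (r / 2 * \<theta> * (1 - \<theta>) * (norm (x - y))\<^sup>2))"
    by (cases "f ?z"; cases "g ?z") (auto simp: algebra_simps add_divide_distrib)
  also have "\<dots> \<le> (ereal (1 - \<theta>) * f x + ereal \<theta> * f y) + (ereal (1 - \<theta>) * g x + ereal \<theta> * g y)"
    by (intro add_mono f[unfolded strongly_convex_fun_def, rule_format, OF \<theta>]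
        g[unfolded strongly_convex_fun_def, rule_format, OF \<theta>])
  also have "\<dots> = ereal (1 - \<theta>) * (f x + g x) + ereal \<theta> * (f y + g y)"
    using \<theta> fin[of x] fin[of y]
    by (cases "f x"; cases "f y"; cases "g x"; cases "g y") (auto simp: algebra_simps)
  finally show "f ?z + g ?z + ereal ((s + r) / 2 * \<theta> * (1 - \<theta>) * (norm (x - y))\<^sup>2) \<le>
      ereal (1 - \<theta>) * (f x + g x) + ereal \<theta> * (f y + g y)" .
qed

lemma strongly_convex_fun_affine:
  fixes a :: "'a::real_inner"
  shows "strongly_convex_fun 0 (\<lambda>x. ereal (a \<bullet> x + d))"
  unfolding strongly_convex_fun_def by (auto simp: inner_simps algebra_simps)

lemma strongly_convex_fun_square:
  fixes v :: "'a::real_inner"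
  shows "strongly_convex_fun \<alpha> (\<lambda>x. ereal (\<alpha> / 2 * (norm (x - v))\<^sup>2))"
  unfolding strongly_convex_fun_def
proof (intro allI impI)
  fix x y :: 'a and \<theta> :: real
  have "(norm ((1 - \<theta>) *\<^sub>R x + \<theta> *\<^sub>R y - v))\<^sup>2 + \<theta> * (1 - \<theta>) * (norm (x - y))\<^sup>2 =
      (1 - \<theta>) * (norm (x - v))\<^sup>2 + \<theta> * (norm (y - v))\<^sup>2"
    by (simp add: power2_norm_eq_inner inner_simps inner_commute algebra_simps)
  then have "\<alpha> / 2 * (norm ((1 - \<theta>) *\<^sub>R x + \<theta> *\<^sub>R y - v))\<^sup>2 + \<alpha> / 2 * (\<theta> * (1 - \<theta>) * (norm (x - y))\<^sup>2) =
      \<alpha> / 2 * ((1 - \<theta>) * (norm (x - v))\<^sup>2 + \<theta> * (norm (y - v))\<^sup>2)"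
    by (metis distrib_left)
  then show "ereal (\<alpha> / 2 * (norm ((1 - \<theta>) *\<^sub>R x + \<theta> *\<^sub>R y - v))\<^sup>2) +
      ereal (\<alpha> / 2 * \<theta> * (1 - \<theta>) * (norm (x - y))\<^sup>2) \<le>
      ereal (1 - \<theta>) * ereal (\<alpha> / 2 * (norm (x - v))\<^sup>2) + ereal \<theta> * ereal (\<alpha> / 2 * (norm (y - v))\<^sup>2)"
    by (simp add: algebra_simps add_divide_distrib diff_divide_distrib)
qed

lemma closed_sublevel:
  fixes f :: "'a::topological_space \<Rightarrow> ereal"
  assumes "closed_fun f"
  shows "closed {x. f x \<le> ereal r}"
proof -
  have "closed ((\<lambda>x. (x, r)) -` epi f)"
    using assms unfolding closed_fun_def by (intro closed_vimage continuous_intros)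
  then show ?thesis by (simp add: vimage_def)
qed

text \<open>A point lies strictly below the graph of the sum iff its height is below
  \<open>p + q\<close> for reals \<open>p\<close>, \<open>q\<close> strictly below the two values.
  This writes the complement of the epigraph as a union of open products.\<close>

lemma closed_fun_add:
  fixes f g :: "'a::topological_space \<Rightarrow> ereal"
  assumes "closed_fun f" "closed_fun g" and fin: "\<And>x. f x \<noteq> -\<infinity>" "\<And>x. g x \<noteq> -\<infinity>"
  shows "closed_fun (\<lambda>x. f x + g x)"
proof -
  have split: "\<exists>p q. ereal p < a \<and> ereal q < b \<and> s < p + q"
    if "ereal s < a + b" "a \<noteq> -\<infinity>" "b \<noteq> -\<infinity>" for a b s
  proof (cases a)
    case (real x)
    then have "ereal (s - x) < b"
      using that by (cases b) auto
    then obtain q where q: "ereal (s - x) < ereal q" "ereal q < b"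
      using ereal_dense2 by blast
    \<comment> \<open>\<open>q\<close> exceeds \<open>s - x\<close>; taking half of the excess off
      \<open>x\<close> keeps the sum above \<open>s\<close>.\<close>
    then show ?thesis
      using real by (intro exI[of _ "x - (q - (s - x)) / 2"] exI[of _ q]) (auto simp: field_simps)
  next
    case PInf
    obtain q where "ereal q < b"
      using \<open>b \<noteq> -\<infinity>\<close> by (metis ereal_dense2 ereal_infty_less(2))
    then show ?thesis
      using PInf by (intro exI[of _ "s - q + 1"] exI[of _ q]) auto
  qed (use that in auto)
  have "- epi (\<lambda>x. f x + g x) =
      (\<Union>w. (- {x. f x \<le> ereal (fst w)} \<inter> - {x. g x \<le> ereal (snd w)}) \<times> {..<fst w + snd w})"
    (is "?L = ?R")
  proof (intro set_eqI iffI)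
    fix z assume z: "z \<in> ?L"
    then obtain p q where "ereal p < f (fst z)" "ereal q < g (fst z)" "snd z < p + q"
      using split[of "snd z" "f (fst z)" "g (fst z)"] fin[of "fst z"]
      by (cases z) (auto simp: not_le)
    then show "z \<in> ?R"
      by (intro UN_I[of "(p, q)"]) (auto simp: mem_Times_iff)
  next
    fix z assume "z \<in> ?R"
    then obtain w where "ereal (fst w) < f (fst z)" "ereal (snd w) < g (fst z)"
        "snd z < fst w + snd w"
      by (elim UN_E) (simp add: mem_Times_iff not_le, blast)
    then have "ereal (snd z) < ereal (fst w) + ereal (snd w)"
        "ereal (fst w) + ereal (snd w) \<le> f (fst z) + g (fst z)"
      using add_mono[of "ereal (fst w)" "f (fst z)" "ereal (snd w)" "g (fst z)"] by auto
    then have "ereal (snd z) < f (fst z) + g (fst z)" by (rule less_le_trans)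
    then show "z \<in> ?L" by (cases z) (simp add: not_le)
  qed
  moreover have "open ?R"
    using assms(1,2) by (auto intro!: open_Times open_Int simp: open_Compl closed_sublevel)
  ultimately show ?thesis
    unfolding closed_fun_def closed_def by simp
qed

lemma closed_fun_continuous:
  fixes h :: "'a::topological_space \<Rightarrow> real"
  assumes "continuous_on UNIV h"
  shows "closed_fun (\<lambda>x. ereal (h x))"
proof -
  have "closed {z :: 'a \<times> real. h (fst z) \<le> snd z}"
    by (intro closed_Collect_le continuous_intros continuous_on_compose2[OF assms]) auto
  then show ?thesis
    unfolding closed_fun_def epi_def by (simp add: case_prod_unfold)
qed

text \<open>A hyperplane separates the epigraph from a point one unit below the graph. Since the
  graph point above it lies on the other side, the normal has a positive vertical component
  \<open>k\<close>, and the hyperplane is the graph of an affine function.\<close>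

lemma affine_minorant:
  fixes f :: "'a::euclidean_space \<Rightarrow> ereal"
  assumes "proper_fun f" "convex_fun f" "closed_fun f"
  obtains a d where "\<And>x. ereal (a \<bullet> x + d) \<le> f x"
proof -
  obtain x0 y0 where x0: "f x0 = ereal y0"
    using assms(1) unfolding proper_fun_def by (metis ereal_cases)
  have "(x0, y0 - 1) \<notin> epi f" by (simp add: x0)
  then obtain u d where u: "u \<bullet> (x0, y0 - 1) < d" "\<And>z. z \<in> epi f \<Longrightarrow> u \<bullet> z > d"
    using separating_hyperplane_closed_point[of "epi f" "(x0, y0 - 1)"] assms(2,3)
    unfolding convex_fun_def closed_fun_def by blast
  obtain a k where ak: "u = (a, k)" by fastforce
  have "(x0, y0) \<in> epi f" by (simp add: x0)
  then have "d < a \<bullet> x0 + k * y0" "a \<bullet> x0 + k * (y0 - 1) < d"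
    using u ak by fastforce+
  then have "k > 0" by (simp add: algebra_simps)
  have "ereal ((- (1 / k) *\<^sub>R a) \<bullet> x + d / k) \<le> f x" for x
  proof (cases "f x")
    case (real r)
    then have "d < a \<bullet> x + k * r"
      using u(2)[of "(x, r)"] ak by simp
    then show ?thesis using \<open>k > 0\<close> real by (simp add: field_simps)
  next
    case MInf
    then show ?thesis using assms(1) unfolding proper_fun_def by auto
  qed auto
  then show ?thesis using that by blast
qed

text \<open>Closedness is a property of the epigraph, so the height \<open>snd\<close> is minimised
  over the truncated epigraph \<open>S\<close>; the growth bound makes \<open>S\<close>
  compact.\<close>

lemma minimizer_exists:
  fixes f :: "'a::euclidean_space \<Rightarrow> ereal"
  assumes "closed_fun f" "f x1 < \<infinity>" "k > 0"
    and growth: "\<And>x. ereal (k * (norm (x - z))\<^sup>2 + d) \<le> f x"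
  obtains x0 m where "f x0 = ereal m" "\<And>x. f x0 \<le> f x"
proof -
  have lb: "ereal d \<le> f x" for x
    using order_trans[OF _ growth[of x]] \<open>k > 0\<close> by simp
  obtain r where r: "f x1 = ereal r"
    using lb[of x1] assms(2) by (cases "f x1") auto
  define S where "S = epi f \<inter> {w. snd w \<le> r}"
  have closed: "closed S"
    unfolding S_def using assms(1) unfolding closed_fun_def
    by (intro closed_Int closed_Collect_le continuous_intros) auto
  have "S \<subseteq> cball z (sqrt ((r - d) / k)) \<times> {d..r}"
  proof
    fix w assume "w \<in> S"
    then obtain x s where w: "w = (x, s)" "f x \<le> ereal s" "s \<le> r"
      unfolding S_def by (cases w) auto
    have "ereal (k * (norm (x - z))\<^sup>2 + d) \<le> ereal s"
      using growth[of x] w(2) by (rule order_trans)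
    then have "(norm (x - z))\<^sup>2 \<le> (r - d) / k"
      using \<open>k > 0\<close> w(3) by (simp add: field_simps)
    then have "norm (x - z) \<le> sqrt ((r - d) / k)" by (rule real_le_rsqrt)
    moreover have "d \<le> s" using lb[of x] w(2) by (metis ereal_less_eq(3) order_trans)
    ultimately show "w \<in> cball z (sqrt ((r - d) / k)) \<times> {d..r}"
      using w by (simp add: dist_norm norm_minus_commute)
  qed
  then have bounded: "bounded S"
    by (rule bounded_subset[OF bounded_Times[OF bounded_cball compact_imp_bounded[OF compact_Icc]]])
  have "(x1, r) \<in> S" using r by (simp add: S_def)
  then have "S \<noteq> {}" by blast
  moreover have "compact S" using closed bounded by (simp add: compact_eq_bounded_closed)
  moreover have "continuous_on S snd" by (intro continuous_intros)
  ultimately obtain w where w: "w \<in> S" "\<And>v. v \<in> S \<Longrightarrow> snd w \<le> snd v"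
    using continuous_attains_inf[of S snd] by blast
  obtain x0 s where ws: "w = (x0, s)" by fastforce
  have x0: "f x0 \<le> ereal s" "s \<le> r" using w(1) ws by (auto simp: S_def)
  have min: "f x0 \<le> f x" for x
  proof (cases "f x \<le> ereal r")
    case True
    then obtain t where t: "f x = ereal t"
      using lb[of x] by (cases "f x") auto
    then have "s \<le> t" using w(2)[of "(x, t)"] ws True by (auto simp: S_def)
    then show ?thesis using x0(1) t by (metis ereal_less_eq(3) order_trans)
  next
    case False
    then show ?thesis using x0 by (metis ereal_less_eq(3) linear order_trans)
  qed
  obtain m where "f x0 = ereal m"
    using x0 lb[of x0] by (cases "f x0") auto
  then show ?thesis using that min by blast
qed

text \<open>The minimum is compared with the value at
  \<open>z *\<^sub>R x0 + (1 - z) *\<^sub>R x\<close>; the factor \<open>1 - z\<close> cancels and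
  \<open>z\<close> tends to 1.\<close>

lemma strongly_convex_minimizer_growth:
  assumes f: "strongly_convex_fun \<sigma> f" and m: "f x0 = ereal m" and min: "\<And>x. f x0 \<le> f x"
  shows "ereal (m + \<sigma> / 2 * (norm (x - x0))\<^sup>2) \<le> f x"
proof (cases "f x")
  case (real s)
  have "z * (\<sigma> / 2 * (norm (x - x0))\<^sup>2) \<le> s - m" if z: "0 < z" "z < 1" for z
  proof -
    have "ereal m + ereal (\<sigma> / 2 * (1 - z) * (1 - (1 - z)) * (norm (x0 - x))\<^sup>2) \<le>
        f ((1 - (1 - z)) *\<^sub>R x0 + (1 - z) *\<^sub>R x) +
        ereal (\<sigma> / 2 * (1 - z) * (1 - (1 - z)) * (norm (x0 - x))\<^sup>2)"
      using min m by (intro add_right_mono) metis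
    also have "\<dots> \<le> ereal (1 - (1 - z)) * f x0 + ereal (1 - z) * f x"
      using f z unfolding strongly_convex_fun_def by (smt (verit))
    finally have "(1 - z) * (z * (\<sigma> / 2 * (norm (x - x0))\<^sup>2)) \<le> (1 - z) * (s - m)"
      by (simp add: m real norm_minus_commute algebra_simps)
    then show ?thesis using z by simp
  qed
  then show ?thesis
    using field_le_mult_one_interval[of "\<sigma> / 2 * (norm (x - x0))\<^sup>2" "s - m"] real by simp
next
  case MInf
  then show ?thesis using min[of x] m by simp
qed auto

lemma strongly_convex_minimizer:
  fixes f :: "'a::euclidean_space \<Rightarrow> ereal"
  assumes "proper_fun f" "closed_fun f" "strongly_convex_fun \<sigma> f" "\<sigma> > 0"
  obtains x0 m where "f x0 = ereal m" "\<And>x. f x0 \<le> f x"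
proof -
  obtain a d where minor: "\<And>x. ereal (a \<bullet> x + d) \<le> f x"
    using affine_minorant[OF assms(1) strongly_convex_imp_convex_fun[OF assms(3)] assms(2)] assms(4)
    by auto
  obtain x1 y1 where x1: "f x1 = ereal y1"
    using assms(1) unfolding proper_fun_def by (metis ereal_cases)
  \<comment> \<open>Strong convexity at the midpoint of \<open>x1\<close> and \<open>x\<close> turns the affine minorant into a quadratic one.\<close>
  have quad: "ereal (\<sigma> / 4 * (norm (x - x1))\<^sup>2 + a \<bullet> x + (a \<bullet> x1 + 2 * d - y1)) \<le> f x" for x
  proof (cases "f x")
    case (real s)
    have "ereal (a \<bullet> ((1/2) *\<^sub>R x1 + (1/2) *\<^sub>R x) + d) + ereal (\<sigma> / 2 * (1/2) * (1 - 1/2) * (norm (x1 - x))\<^sup>2) \<le>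
        f ((1 - 1/2) *\<^sub>R x1 + (1/2) *\<^sub>R x) + ereal (\<sigma> / 2 * (1/2) * (1 - 1/2) * (norm (x1 - x))\<^sup>2)"
      using minor[of "(1/2) *\<^sub>R x1 + (1/2) *\<^sub>R x"] by (intro add_right_mono) simp
    also have "\<dots> \<le> ereal (1 - 1/2) * f x1 + ereal (1/2) * f x"
      using assms(3) unfolding strongly_convex_fun_def by (metis half_gt_zero_iff less_numeral_extra(1) field_sum_of_halves less_add_same_cancel1)
    finally show ?thesis
      by (simp add: x1 real norm_minus_commute inner_simps field_simps)
  next
    case MInf
    then show ?thesis using assms(1) by (auto simp: proper_fun_def)
  qed auto
  \<comment> \<open>Completing the square moves the linear term into the centre, as the growth
    hypothesis of \<open>minimizer_exists\<close> requires.\<close>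
  have growth: "ereal (\<sigma> / 4 * (norm (x - (x1 - (2 / \<sigma>) *\<^sub>R a)))\<^sup>2 +
      (a \<bullet> x1 - \<sigma> / 4 * (norm ((2 / \<sigma>) *\<^sub>R a))\<^sup>2 + (a \<bullet> x1 + 2 * d - y1))) \<le> f x" for x
  proof -
    define w where "w = (2 / \<sigma>) *\<^sub>R a"
    have "\<sigma> / 4 * (norm (x - (x1 - w)))\<^sup>2 =
        \<sigma> / 4 * (norm (x - x1))\<^sup>2 + \<sigma> / 2 * (w \<bullet> (x - x1)) + \<sigma> / 4 * (norm w)\<^sup>2"
      by (simp add: power2_norm_eq_inner inner_simps inner_commute algebra_simps)
    moreover have "\<sigma> / 2 * (w \<bullet> (x - x1)) = a \<bullet> x - a \<bullet> x1"
      using \<open>\<sigma> > 0\<close> by (simp add: w_def inner_diff_right field_simps)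
    ultimately have "\<sigma> / 4 * (norm (x - (x1 - w)))\<^sup>2 + (a \<bullet> x1 - \<sigma> / 4 * (norm w)\<^sup>2 + (a \<bullet> x1 + 2 * d - y1)) =
        \<sigma> / 4 * (norm (x - x1))\<^sup>2 + a \<bullet> x + (a \<bullet> x1 + 2 * d - y1)"
      by linarith
    then show ?thesis
      using quad[of x] by (simp only: w_def)
  qed
  have "f x1 < \<infinity>" "\<sigma> / 4 > 0" using x1 \<open>\<sigma> > 0\<close> by simp_all
  from minimizer_exists[OF assms(2) this growth] that show ?thesis by metis
qed

section \<open>Conjugates and proximal steps\<close>

text \<open>\<open>u v\<close> is the maximiser of \<open>v \<bullet> x - f x\<close>, which is the
  gradient of the conjugate at \<open>v\<close>. Both bounds come from testing the quadratic growth
  of one tilted problem at the minimiser of another.\<close>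

lemma conjugate_strongly_convex:
  fixes f :: "'a::euclidean_space \<Rightarrow> ereal"
  assumes "proper_fun f" "closed_fun f" "strongly_convex_fun \<sigma> f" "\<sigma> > 0"
  obtains F u where "\<And>v. conjugate f v = ereal (F v)"
    "\<And>v w. F v + u v \<bullet> (w - v) \<le> F w"
    "\<And>v w. F w \<le> F v + u v \<bullet> (w - v) + (norm (w - v))\<^sup>2 / (2 * \<sigma>)"
proof -
  have fin: "f x \<noteq> -\<infinity>" for x
    using assms(1) by (auto simp: proper_fun_def)
  have "\<exists>u m. f u = ereal (m + v \<bullet> u) \<and> (\<forall>x. ereal (m + \<sigma> / 2 * (norm (x - u))\<^sup>2 + v \<bullet> x) \<le> f x)" for v
  proof -
    let ?\<phi> = "\<lambda>x. f x + ereal ((- v) \<bullet> x + 0)"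
    have closed: "closed_fun ?\<phi>"
      using fin by (intro closed_fun_add assms closed_fun_continuous continuous_intros) auto
    have sc: "strongly_convex_fun (\<sigma> + 0) ?\<phi>"
      using fin by (intro strongly_convex_fun_add assms strongly_convex_fun_affine) auto
    have "proper_fun ?\<phi>"
      using assms(1) unfolding proper_fun_def by auto
    then obtain u m where um: "?\<phi> u = ereal m" "\<And>x. ?\<phi> u \<le> ?\<phi> x"
      using strongly_convex_minimizer[OF _ closed sc] assms(4) by auto
    have "ereal (m + \<sigma> / 2 * (norm (x - u))\<^sup>2 + v \<bullet> x) \<le> f x" for x
      using strongly_convex_minimizer_growth[OF sc um, of x] by (cases "f x") auto
    moreover have "f u = ereal (m + v \<bullet> u)"
      using um(1) by (cases "f u") auto
    ultimately show ?thesis by blast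
  qed
  then obtain u m where fu: "\<And>v. f (u v) = ereal (m v + v \<bullet> u v)"
    and growth: "\<And>v x. ereal (m v + \<sigma> / 2 * (norm (x - u v))\<^sup>2 + v \<bullet> x) \<le> f x"
    by metis
  have "conjugate f v = ereal (- m v)" for v
    unfolding conjugate_def
  proof (intro antisym SUP_least)
    fix x
    have "ereal (m v + v \<bullet> x) \<le> f x"
      using order_trans[OF _ growth[of v x]] assms(4) by simp
    then show "ereal (v \<bullet> x) - f x \<le> ereal (- m v)"
      by (cases "f x") auto
  next
    show "ereal (- m v) \<le> (SUP x. ereal (v \<bullet> x) - f x)"
      by (rule SUP_upper2[of "u v"]) (simp_all add: fu)
  qed
  moreover have "- m v + u v \<bullet> (w - v) \<le> - m w" for v w
  proof -
    have "ereal (m w + w \<bullet> u v) \<le> f (u v)"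
      using order_trans[OF _ growth[of w "u v"]] assms(4) by simp
    then show ?thesis by (simp add: fu inner_diff_right inner_commute)
  qed
  moreover have "- m w \<le> - m v + u v \<bullet> (w - v) + (norm (w - v))\<^sup>2 / (2 * \<sigma>)" for v w
  proof -
    let ?D = "u w - u v"
    \<comment> \<open>Expanding the square gives Young's inequality with weight \<sigma>; its term
      in \<open>?D\<close> alone cancels the growth of the problem for \<open>v\<close> at
      \<open>u w\<close>.\<close>
    have "0 \<le> (norm ((w - v) - \<sigma> *\<^sub>R ?D))\<^sup>2 / (2 * \<sigma>)"
      using assms(4) by simp
    also have "(norm ((w - v) - \<sigma> *\<^sub>R ?D))\<^sup>2 =
        (norm (w - v))\<^sup>2 - 2 * \<sigma> * ((w - v) \<bullet> ?D) + \<sigma> * \<sigma> * (norm ?D)\<^sup>2"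
      unfolding power2_norm_eq_inner
      by (simp add: inner_simps inner_commute algebra_simps)
    also have "\<dots> / (2 * \<sigma>) = (norm (w - v))\<^sup>2 / (2 * \<sigma>) - (w - v) \<bullet> ?D + \<sigma> / 2 * (norm ?D)\<^sup>2"
      using assms(4) by (simp add: add_divide_distrib diff_divide_distrib)
    finally have "(w - v) \<bullet> ?D \<le> (norm (w - v))\<^sup>2 / (2 * \<sigma>) + \<sigma> / 2 * (norm ?D)\<^sup>2"
      by linarith
    moreover have "m v + \<sigma> / 2 * (norm ?D)\<^sup>2 + v \<bullet> u w \<le> m w + w \<bullet> u w"
      using growth[of v "u w"] by (simp add: fu)
    ultimately show ?thesis
      by (simp add: inner_diff_right inner_diff_left inner_commute)
  qed
  ultimately show ?thesis using that[of "\<lambda>v. - m v" u] by blast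
qed

lemma GDERIV_quadratic_bound:
  fixes \<phi> :: "'a::real_inner \<Rightarrow> real"
  assumes "\<And>y. \<bar>\<phi> y - \<phi> x - g \<bullet> (y - x)\<bar> \<le> k * (norm (y - x))\<^sup>2"
  shows "GDERIV \<phi> x :> g"
  unfolding gderiv_def
proof (rule has_derivativeI_sandwich[of 1])
  show "bounded_linear (\<lambda>h. h \<bullet> g)" by (rule bounded_linear_inner_left)
  show "norm (\<phi> y - \<phi> x - (y - x) \<bullet> g) / norm (y - x) \<le> k * norm (y - x)" if "y \<noteq> x" for y
    using assms[of y] that by (simp add: field_simps power2_eq_square inner_commute)
  have "((\<lambda>y. k * norm (y - x)) \<longlongrightarrow> k * norm (x - x)) (at x)"
    by (intro tendsto_intros)
  then show "((\<lambda>y. k * norm (y - x)) \<longlongrightarrow> 0) (at x)" by simp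
qed simp

text \<open>Derivatives are unique, so the definite description in \<open>gradient\<close> denotes
  any gradient that has been exhibited.\<close>

lemma gradient_eqI:
  assumes "has_gradient f g x"
  shows "gradient f x = g"
  unfolding gradient_def
proof (rule the_equality)
  fix g' assume "has_gradient f g' x"
  then have "(\<lambda>h. h \<bullet> g') = (\<lambda>h. h \<bullet> g)"
    using assms unfolding has_gradient_def gderiv_def by (metis has_derivative_unique)
  then show "g' = g" by (metis inner_commute inner_diff_left inner_eq_zero_iff right_minus_eq)
qed (fact assms)

section \<open>Block decomposition and smoothness of \<open>P\<close>\<close>

lemma blk_diff: "blk i (x - y) = blk i x - blk i y"
  by (simp add: blk_def vec_eq_iff)

lemma linear_blk: "linear (blk i)"
  by (rule linearI) (simp_all add: blk_def vec_eq_iff)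

lemma inner_blk: "x \<bullet> y = (\<Sum>i\<in>UNIV. blk i x \<bullet> blk i y)"
  unfolding inner_vec_def blk_def by (simp add: sum.cartesian_product)

lemma norm_blk: "(\<Sum>i\<in>UNIV. (norm (blk i x))\<^sup>2) = (norm x)\<^sup>2"
  by (simp add: power2_norm_eq_inner inner_blk[of x])

lemma exists_blk: "\<exists>x. \<forall>i. blk i x = w i"
  by (rule exI[of _ "\<chi> p. w (fst p) $ snd p"]) (simp add: blk_def vec_eq_iff)

text \<open>The bounds for each conjugate are pulled back along \<open>H_mat (A i)\<close>, which
  costs the squared spectral norm, and are summed over the blocks.\<close>

lemma P_fun_smooth:
  fixes f :: "'n::finite \<Rightarrow> real^'m \<Rightarrow> ereal" and A :: "'n \<Rightarrow> real^'m^'b"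
  assumes f: "\<And>i. proper_fun (f i)" "\<And>i. closed_fun (f i)"
      "\<And>i. strongly_convex_fun (\<sigma> i) (f i)" "\<And>i. \<sigma> i > 0"
  defines "h \<equiv> Max (range (\<lambda>i. (spectral_norm (H_mat (A i)))\<^sup>2 / \<sigma> i))"
  obtains p where "\<And>l. P_fun f A b \<kappa> l = ereal (p l)"
    "\<And>l l'. p l + gradient (P_fun f A b \<kappa>) l \<bullet> (l' - l) \<le> p l'"
    "\<And>l l'. p l' \<le> p l + gradient (P_fun f A b \<kappa>) l \<bullet> (l' - l) + h / 2 * (norm (l' - l))\<^sup>2"
proof -
  have "\<forall>i. \<exists>F u. (\<forall>v. conjugate (f i) v = ereal (F v)) \<and>
      (\<forall>v w. F v + u v \<bullet> (w - v) \<le> F w) \<and>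
      (\<forall>v w. F w \<le> F v + u v \<bullet> (w - v) + (norm (w - v))\<^sup>2 / (2 * \<sigma> i))"
    by (metis conjugate_strongly_convex[OF f])
  then obtain F u where F: "\<And>i v. conjugate (f i) v = ereal (F i v)"
    and lower: "\<And>i v w. F i v + u i v \<bullet> (w - v) \<le> F i w"
    and upper: "\<And>i v w. F i w \<le> F i v + u i v \<bullet> (w - v) + (norm (w - v))\<^sup>2 / (2 * \<sigma> i)"
    by metis
  define H where "H i = H_mat (A i)" for i
  define p where "p l = (\<Sum>i\<in>UNIV. F i (H i *v blk i l) + \<kappa> i * (E_vec b \<bullet> blk i l))" for l
  have P: "P_fun f A b \<kappa> l = ereal (p l)" for l
    by (simp add: P_fun_def p_fun_def F p_def H_def)
  \<comment> \<open>The candidate gradient, block by block, as the chain rule predicts it.\<close>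
  have "\<forall>l. \<exists>G. \<forall>i. blk i G = transpose (H i) *v u i (H i *v blk i l) + \<kappa> i *\<^sub>R E_vec b"
    by (intro allI exists_blk)
  then obtain G where G: "\<And>l i. blk i (G l) = transpose (H i) *v u i (H i *v blk i l) + \<kappa> i *\<^sub>R E_vec b"
    by metis
  have inner_G: "G l \<bullet> (l' - l) = (\<Sum>i\<in>UNIV. u i (H i *v blk i l) \<bullet> (H i *v blk i l' - H i *v blk i l)
      + \<kappa> i * (E_vec b \<bullet> blk i l') - \<kappa> i * (E_vec b \<bullet> blk i l))" for l l'
    unfolding inner_blk G blk_diff
    by (intro sum.cong) (simp_all add: inner_add_left inner_diff_right transpose_matrix_vector
        dot_lmul_matrix matrix_vector_mult_diff_distrib right_diff_distrib)
  have p_lower: "p l + G l \<bullet> (l' - l) \<le> p l'" for l l'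
    unfolding inner_G p_def sum.distrib[symmetric]
    using lower by (intro sum_mono) (simp add: algebra_simps)
  have H_bound: "(norm (H i *v x))\<^sup>2 / (2 * \<sigma> i) \<le> h / 2 * (norm x)\<^sup>2" for i x
  proof -
    have "norm (H i *v x) \<le> spectral_norm (H i) * norm x"
      unfolding spectral_norm_def by (rule onorm) simp
    then have "(norm (H i *v x))\<^sup>2 \<le> (spectral_norm (H i))\<^sup>2 * (norm x)\<^sup>2"
      by (metis norm_ge_zero power_mono power_mult_distrib)
    then have "(norm (H i *v x))\<^sup>2 / (2 * \<sigma> i) \<le> (spectral_norm (H i))\<^sup>2 * (norm x)\<^sup>2 / (2 * \<sigma> i)"
      using f(4)[of i] by (intro divide_right_mono) auto
    also have "\<dots> = ((spectral_norm (H i))\<^sup>2 / \<sigma> i) * ((norm x)\<^sup>2 / 2)"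
      by simp
    also have "\<dots> \<le> h * ((norm x)\<^sup>2 / 2)"
      unfolding h_def H_def by (intro mult_right_mono Max_ge) auto
    finally show ?thesis by simp
  qed
  have p_upper: "p l' \<le> p l + G l \<bullet> (l' - l) + h / 2 * (norm (l' - l))\<^sup>2" for l l'
  proof -
    have "p l' \<le> p l + G l \<bullet> (l' - l) + (\<Sum>i\<in>UNIV. (norm (H i *v blk i l' - H i *v blk i l))\<^sup>2 / (2 * \<sigma> i))"
      unfolding inner_G p_def sum.distrib[symmetric]
      using upper by (intro sum_mono) (simp add: algebra_simps)
    also have "(\<Sum>i\<in>UNIV. (norm (H i *v blk i l' - H i *v blk i l))\<^sup>2 / (2 * \<sigma> i)) \<le>
        (\<Sum>i\<in>UNIV. h / 2 * (norm (blk i (l' - l)))\<^sup>2)"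
      using H_bound by (intro sum_mono) (metis blk_diff matrix_vector_mult_diff_distrib)
    also have "\<dots> = h / 2 * (norm (l' - l))\<^sup>2"
      by (simp only: sum_distrib_left[symmetric] norm_blk)
    finally show ?thesis by simp
  qed
  \<comment> \<open>The two bounds leave a quadratic remainder, so differentiability of
    \<open>p\<close> is a consequence of them.\<close>
  have "GDERIV p l :> G l" for l
  proof (rule GDERIV_quadratic_bound)
    show "\<bar>p y - p l - G l \<bullet> (y - l)\<bar> \<le> h / 2 * (norm (y - l))\<^sup>2" for y
      using p_lower[of l y] p_upper[of y l] by linarith
  qed
  then have "has_gradient (P_fun f A b \<kappa>) (G l) l" for l
    by (simp add: has_gradient_def P)
  then have "gradient (P_fun f A b \<kappa>) l = G l" for l
    by (rule gradient_eqI)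
  then show ?thesis
    using that[of p] P p_lower p_upper by simp
qed

section \<open>\<open>Q\<close> as a proper, closed and convex function\<close>

lemma epi_conjugate:
  "epi (conjugate \<psi>) = (\<Inter>u. {z. ereal (fst z \<bullet> u) - \<psi> u \<le> ereal (snd z)})"
  by (auto simp: epi_def conjugate_def SUP_le_iff)

text \<open>For finite \<open>\<psi> u\<close> the set is a half-space with normal
  \<open>(u, -1)\<close>; otherwise it is empty or the whole space. The epigraph of the conjugate is
  the intersection of these sets.\<close>

lemma conjugate_affine_epi:
  fixes \<psi> :: "'a::real_inner \<Rightarrow> ereal"
  shows "convex {z. ereal (fst z \<bullet> u) - \<psi> u \<le> ereal (snd z)}"
    and "closed {z. ereal (fst z \<bullet> u) - \<psi> u \<le> ereal (snd z)}"
proof -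
  let ?S = "{z. ereal (fst z \<bullet> u) - \<psi> u \<le> ereal (snd z)}"
  have "convex ?S \<and> closed ?S"
  proof (cases "\<psi> u")
    case (real r)
    then have "?S = {z. (u, -1) \<bullet> z \<le> r}"
      by (auto simp: inner_commute)
    then show ?thesis
      by (metis convex_halfspace_le closed_halfspace_le)
  qed auto
  then show "convex ?S" "closed ?S" by auto
qed

lemma convex_fun_conjugate: "convex_fun (conjugate \<psi>)"
  unfolding convex_fun_def epi_conjugate by (intro convex_INT conjugate_affine_epi)

lemma closed_fun_conjugate: "closed_fun (conjugate \<psi>)"
  unfolding closed_fun_def epi_conjugate by (intro closed_INT ballI conjugate_affine_epi)

lemma conjugate_not_MInf:
  assumes "proper_fun \<psi>"
  shows "conjugate \<psi> v \<noteq> -\<infinity>"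
proof -
  obtain u r where "\<psi> u = ereal r"
    using assms unfolding proper_fun_def by (metis ereal_cases)
  then have "ereal (v \<bullet> u - r) \<le> conjugate \<psi> v"
    unfolding conjugate_def by (intro SUP_upper2[of u]) auto
  then show ?thesis by auto
qed

text \<open>The slope of an affine minorant of \<psi> lies in the domain of the conjugate.\<close>

lemma conjugate_not_PInf:
  fixes \<psi> :: "'a::euclidean_space \<Rightarrow> ereal"
  assumes "proper_fun \<psi>" "convex_fun \<psi>" "closed_fun \<psi>"
  shows "\<exists>v. conjugate \<psi> v \<noteq> \<infinity>"
proof -
  obtain a d where minor: "\<And>x. ereal (a \<bullet> x + d) \<le> \<psi> x"
    using affine_minorant[OF assms] by blast
  have "ereal (a \<bullet> x) - \<psi> x \<le> ereal (- d)" for x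
    using minor[of x] by (cases "\<psi> x") auto
  then have "conjugate \<psi> a \<le> ereal (- d)"
    unfolding conjugate_def by (rule SUP_least)
  then show ?thesis by (intro exI[of _ a]) auto
qed

lemma epi_add_indicator:
  assumes "\<And>x. g x \<noteq> -\<infinity>"
  shows "epi (\<lambda>x. g x + indicator_fun S x) = epi g \<inter> S \<times> UNIV"
  using assms by (auto simp: epi_def indicator_fun_def split: if_splits)

lemma strongly_convex_fun_compose_linear:
  assumes "strongly_convex_fun 0 f" "linear L"
  shows "strongly_convex_fun 0 (\<lambda>x. f (L x))"
  using assms unfolding strongly_convex_fun_def
  by (simp add: linear_add linear_cmul)

lemma closed_fun_compose:
  assumes "closed_fun f" "continuous_on UNIV L"
  shows "closed_fun (\<lambda>x. f (L x))"
proof -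
  have "closed ((\<lambda>z. (L (fst z), snd z)) -` epi f)"
    using assms(1) unfolding closed_fun_def
    by (intro closed_vimage continuous_intros continuous_on_compose2[OF assms(2)]) auto
  moreover have "(\<lambda>z. (L (fst z), snd z)) -` epi f = epi (\<lambda>x. f (L x))"
    by (auto simp: epi_def)
  ultimately show ?thesis by (simp add: closed_fun_def)
qed

lemma sum_closed_convex:
  fixes q :: "'i \<Rightarrow> 'a::real_normed_vector \<Rightarrow> ereal"
  assumes "finite I" "\<And>i x. q i x \<noteq> -\<infinity>" "\<And>i. closed_fun (q i)" "\<And>i. strongly_convex_fun 0 (q i)"
  shows "(\<forall>x. (\<Sum>i\<in>I. q i x) \<noteq> -\<infinity>) \<and> closed_fun (\<lambda>x. \<Sum>i\<in>I. q i x) \<and>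
    strongly_convex_fun 0 (\<lambda>x. \<Sum>i\<in>I. q i x)"
  using assms(1)
proof induction
  case empty
  have "strongly_convex_fun 0 (\<lambda>x::'a. 0)"
    by (simp add: strongly_convex_fun_def)
  moreover have "closed_fun (\<lambda>x::'a. 0)"
    using closed_fun_continuous[of "\<lambda>x. 0"] by (simp add: zero_ereal_def)
  ultimately show ?case by simp
next
  case (insert i I)
  then show ?case
    using assms(2-4) closed_fun_add[of "q i" "\<lambda>x. \<Sum>i\<in>I. q i x"]
      strongly_convex_fun_add[of 0 "q i" 0 "\<lambda>x. \<Sum>i\<in>I. q i x"]
    by auto
qed

text \<open>Closedness and convexity pass through the linear maps and the sum. Properness needs one
  point at which all summands are finite; the blocks are independent and \<open>F_mat\<close> is
  onto, so it can be chosen block by block.\<close>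

lemma Q_fun_closed_convex_proper:
  fixes g :: "'n::finite \<Rightarrow> real^'m \<Rightarrow> ereal" and X :: "'n \<Rightarrow> (real^'m) set"
  assumes g: "\<And>i. proper_fun (g i)" "\<And>i. convex_fun (g i)" "\<And>i. closed_fun (g i)"
    and X: "\<And>i. convex (X i)" "\<And>i. closed (X i)"
    and gX: "\<And>i. proper_fun (\<lambda>x. g i x + indicator_fun (X i) x)"
  defines "Q \<equiv> Q_fun g X :: real^('n \<times> ('b::finite + 'm)) \<Rightarrow> ereal"
  shows "proper_fun Q" "closed_fun Q" "strongly_convex_fun 0 Q"
proof -
  define \<psi> where "\<psi> i = (\<lambda>x. g i x + indicator_fun (X i) x)" for i
  have epi: "epi (\<psi> i) = epi (g i) \<inter> X i \<times> UNIV" for i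
    using g(1)[of i] unfolding \<psi>_def proper_fun_def by (intro epi_add_indicator) auto
  have \<psi>: "proper_fun (\<psi> i)" "convex_fun (\<psi> i)" "closed_fun (\<psi> i)" for i
    using gX[of i] g(2,3)[of i] X[of i] epi[of i]
    by (auto simp: \<psi>_def convex_fun_def closed_fun_def convex_Int convex_Times closed_Int closed_Times)
  have Q: "Q l = (\<Sum>i\<in>UNIV. conjugate (\<psi> i) (F_mat *v blk i l))" for l
    by (simp add: Q_def Q_fun_def q_fun_def \<psi>_def)
  have lin: "linear (\<lambda>l. (F_mat :: real^('b + 'm)^'m) *v blk i l)" for i
    using linear_compose[OF linear_blk matrix_vector_mul_linear] by (simp add: o_def)
  have "strongly_convex_fun 0 (\<lambda>l. conjugate (\<psi> i) ((F_mat :: real^('b + 'm)^'m) *v blk i l))" for i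
    using \<psi> by (intro strongly_convex_fun_compose_linear[OF _ lin] convex_fun_imp_strongly_convex_0
        convex_fun_conjugate conjugate_not_MInf)
  moreover have "closed_fun (\<lambda>l. conjugate (\<psi> i) ((F_mat :: real^('b + 'm)^'m) *v blk i l))" for i
    by (intro closed_fun_compose[OF closed_fun_conjugate] linear_continuous_on linear_conv_bounded_linear[THEN iffD1] lin)
  ultimately have *: "(\<forall>l. Q l \<noteq> -\<infinity>) \<and> closed_fun Q \<and> strongly_convex_fun 0 Q"
    using sum_closed_convex[of UNIV "\<lambda>i l. conjugate (\<psi> i) ((F_mat :: real^('b + 'm)^'m) *v blk i l)"]
      conjugate_not_MInf[OF \<psi>(1)] unfolding Q[abs_def] by simp
  then show "closed_fun Q" "strongly_convex_fun 0 Q"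
    by auto
  obtain v where v: "\<And>i. conjugate (\<psi> i) (v i) \<noteq> \<infinity>"
    using conjugate_not_PInf[OF \<psi>] by metis
  \<comment> \<open>A preimage of \<open>v i\<close> under \<open>F_mat\<close>, with zero in the
    \<theta> part.\<close>
  define w :: "'n \<Rightarrow> real^('b + 'm)" where "w i = (\<chi> c. case c of Inl s \<Rightarrow> 0 | Inr s \<Rightarrow> v i $ s)" for i
  obtain l where l: "\<And>i. blk i l = w i"
    using exists_blk[of w] by blast
  have "F_mat *v w i = v i" for i
    by (simp add: vec_eq_iff matrix_vector_mult_def F_mat_def w_def mat_def UNIV_Plus_UNIV[symmetric]
        sum.Plus if_distrib[of "\<lambda>x. x * _"] cong: if_cong del: UNIV_Plus_UNIV)
  then have "Q l \<noteq> \<infinity>"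
    by (simp add: Q l sum_Pinfty v)
  with * show "proper_fun Q"
    unfolding proper_fun_def by blast
qed

section \<open>The variational inequality of the proximal step\<close>

text \<open>The conclusion says that \<open>(1 / c) *\<^sub>R (v - u)\<close> is a subgradient of
  \<open>Q\<close> at \<open>u\<close>. It follows from quadratic growth with modulus
  \<open>1 / c\<close> of the proximal objective at its minimiser, without any subdifferential
  calculus.\<close>

lemma prox_inequality:
  fixes Q :: "'a::euclidean_space \<Rightarrow> ereal" and v :: 'a
  assumes Q: "proper_fun Q" "closed_fun Q" "strongly_convex_fun 0 Q" and "c > 0"
  defines "u \<equiv> prox c Q v"
  obtains q where "Q u = ereal q" "\<And>x. ereal (q + (1 / c) * ((v - u) \<bullet> (x - u))) \<le> Q x"
proof -
  let ?\<phi> = "\<lambda>x. Q x + ereal ((1 / c) / 2 * (norm (x - v))\<^sup>2)"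
  have fin: "Q x \<noteq> -\<infinity>" for x
    using Q(1) by (auto simp: proper_fun_def)
  have closed: "closed_fun ?\<phi>"
    using fin by (intro closed_fun_add Q closed_fun_continuous continuous_intros) auto
  have sc: "strongly_convex_fun (0 + 1 / c) ?\<phi>"
    using fin by (intro strongly_convex_fun_add Q strongly_convex_fun_square) auto
  have "proper_fun ?\<phi>"
    using Q(1) unfolding proper_fun_def by auto
  then obtain x0 m where "?\<phi> x0 = ereal m" "\<And>x. ?\<phi> x0 \<le> ?\<phi> x"
    using strongly_convex_minimizer[OF _ closed sc] \<open>c > 0\<close> by auto
  then have "is_arg_min ?\<phi> (\<lambda>_. True) x0"
    by (simp add: is_arg_min_linorder)
  then have "is_arg_min ?\<phi> (\<lambda>_. True) u"
    unfolding u_def prox_def arg_min_def by (simp add: mult.commute) (rule someI)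
  then have min: "?\<phi> u \<le> ?\<phi> x" for x
    by (simp add: is_arg_min_linorder)
  have "?\<phi> u \<le> ereal m" using min[of x0] \<open>?\<phi> x0 = ereal m\<close> by simp
  then obtain q where q: "Q u = ereal q" using fin[of u] by (cases "Q u") auto
  then have val: "?\<phi> u = ereal (q + (1 / c) / 2 * (norm (u - v))\<^sup>2)" by simp
  have "ereal (q + (1 / c) * ((v - u) \<bullet> (x - u))) \<le> Q x" for x
  proof -
    \<comment> \<open>Expanding about \<open>u\<close>: the squares of \<open>x - u\<close> and
      \<open>u - v\<close> cancel against the growth inequality and leave the inner product.\<close>
    have "(norm (x - v))\<^sup>2 = (norm (x - u))\<^sup>2 - 2 * ((v - u) \<bullet> (x - u)) + (norm (u - v))\<^sup>2"
      by (simp add: power2_norm_eq_inner inner_simps inner_commute)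
    then have eq: "(1 / c) / 2 * (norm (x - v))\<^sup>2 = (1 / c) / 2 * (norm (x - u))\<^sup>2
        - (1 / c) * ((v - u) \<bullet> (x - u)) + (1 / c) / 2 * (norm (u - v))\<^sup>2"
      by (simp add: add_divide_distrib diff_divide_distrib)
    show ?thesis
      using strongly_convex_minimizer_growth[OF sc val min, of x] eq fin[of x]
      by (cases "Q x") auto
  qed
  with q show ?thesis using that by blast
qed

section \<open>The largest eigenvalue and edge-indexed vectors\<close>

lemma symmetric_matrix_inner:
  fixes S :: "real^'k^'k"
  assumes "transpose S = S"
  shows "x \<bullet> (S *v y) = (S *v x) \<bullet> y"
  using assms by (metis dot_lmul_matrix transpose_matrix_vector)

text \<open>\<open>Max\<close> is meaningful only for a finite set, so the spectrum is first shown
  finite: eigenvectors of distinct eigenvalues are orthogonal, hence independent. The maximum of the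
  quadratic form on the unit sphere is then shown to be an eigenvalue.\<close>

lemma rayleigh_le_max_eigenvalue:
  fixes S :: "real^'k^'k"
  assumes sym: "transpose S = S"
  shows "v \<bullet> (S *v v) \<le> max_eigenvalue S * (v \<bullet> v)"
proof -
  define T where "T = {\<tau>. \<exists>v. v \<noteq> 0 \<and> S *v v = \<tau> *\<^sub>R v}"
  have "finite T"
  proof -
    have "\<forall>\<tau>\<in>T. \<exists>v. v \<noteq> 0 \<and> S *v v = \<tau> *\<^sub>R v"
      by (simp add: T_def)
    then obtain e where e: "\<And>\<tau>. \<tau> \<in> T \<Longrightarrow> e \<tau> \<noteq> 0 \<and> S *v e \<tau> = \<tau> *\<^sub>R e \<tau>"
      by (metis (no_types))
    have orth: "e \<tau> \<bullet> e \<rho> = 0" if "\<tau> \<in> T" "\<rho> \<in> T" "\<tau> \<noteq> \<rho>" for \<tau> \<rho>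
    proof -
      have "\<rho> * (e \<tau> \<bullet> e \<rho>) = \<tau> * (e \<tau> \<bullet> e \<rho>)"
        using symmetric_matrix_inner[OF sym, of "e \<tau>" "e \<rho>"] e that by simp
      then show ?thesis using that by simp
    qed
    have "inj_on e T"
      by (rule inj_onI) (metis e orth inner_eq_zero_iff)
    moreover have "independent (e ` T)"
      using e orth by (intro pairwise_orthogonal_independent) (auto simp: pairwise_def orthogonal_def)
    ultimately show ?thesis
      using independent_imp_finite finite_imageD by blast
  qed
  let ?r = "\<lambda>v. v \<bullet> (S *v v)"
  have "continuous_on (sphere 0 1) ?r"
    by (intro continuous_intros)
  moreover have "sphere (0 :: real^'k) 1 \<noteq> {}" by simp
  ultimately obtain w where w: "w \<in> sphere 0 1" "\<And>v. v \<in> sphere 0 1 \<Longrightarrow> ?r v \<le> ?r w"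
    using continuous_attains_sup[OF compact_sphere] by blast
  define \<mu> where "\<mu> = ?r w"
  have le: "?r v \<le> \<mu> * (v \<bullet> v)" for v
  proof (cases "v = 0")
    case False
    define k where "k = norm v"
    have k: "k > 0" using False by (simp add: k_def)
    have "?r ((1 / k) *\<^sub>R v) \<le> \<mu>"
      unfolding \<mu>_def by (rule w) (simp add: k_def False)
    then have "?r v / (k * k) \<le> \<mu>"
      by (simp add: matrix_vector_mult_scaleR)
    then have "?r v \<le> \<mu> * (k * k)"
      using k by (simp add: pos_divide_le_eq)
    then show ?thesis by (simp add: k_def norm_eq_sqrt_inner)
  qed simp
  \<comment> \<open>The form \<open>\<mu> (v \<bullet> v) - v \<bullet> S v\<close> is nonnegative and vanishes at \<open>w\<close>, so its gradient there is zero.\<close>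
  define B where "B v = \<mu> * (v \<bullet> v) - ?r v" for v
  define z where "z = \<mu> *\<^sub>R w - S *v w"
  have B_ge: "B v \<ge> 0" for v using le[of v] by (simp add: B_def)
  have ww: "w \<bullet> w = 1" using w(1) by (simp add: norm_eq_1)
  have B_line: "B (w - s *\<^sub>R z) = s * s * B z - 2 * s * (z \<bullet> z)" for s
  proof -
    have "B (w - s *\<^sub>R z) = (\<mu> * (w \<bullet> w) - ?r w) - 2 * s * (\<mu> * (w \<bullet> z) - (S *v w) \<bullet> z) + s * s * B z"
      unfolding B_def
      by (simp add: matrix_vector_mult_diff_distrib matrix_vector_mult_scaleR inner_simps
          symmetric_matrix_inner[OF sym, of w z] inner_commute algebra_simps)
    moreover have "\<mu> * (w \<bullet> z) - (S *v w) \<bullet> z = z \<bullet> z"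
      by (metis z_def inner_diff_left inner_scaleR_left)
    ultimately show ?thesis by (simp add: ww \<mu>_def)
  qed
  have "z \<bullet> z = 0"
  proof (rule ccontr)
    assume "z \<bullet> z \<noteq> 0"
    then have zz: "z \<bullet> z > 0" by (simp add: less_le)
    \<comment> \<open>This step would make \<open>B\<close> negative at
      \<open>w - s *\<^sub>R z\<close>, because \<open>s * B z < z \<bullet> z\<close>; the summand
      1 keeps the denominator positive.\<close>
    define s where "s = (z \<bullet> z) / (B z + 1)"
    have s: "s > 0" "s * (B z + 1) = z \<bullet> z"
      using zz B_ge[of z] by (auto simp: s_def)
    have "0 \<le> s * (s * B z - 2 * (z \<bullet> z))"
      using B_ge[of "w - s *\<^sub>R z"] B_line[of s] by (simp add: algebra_simps)
    then have "2 * (z \<bullet> z) \<le> s * B z"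
      using s(1) by (simp add: zero_le_mult_iff)
    then show False using s zz by (simp add: algebra_simps)
  qed
  then have "\<mu> \<in> T"
    using ww unfolding T_def z_def by (auto intro!: exI[of _ w])
  then have "\<mu> \<le> max_eigenvalue S"
    unfolding max_eigenvalue_def using \<open>finite T\<close> by (simp add: T_def)
  then show ?thesis
    using le[of v] mult_right_mono[of \<mu> "max_eigenvalue S" "v \<bullet> v"] by simp
qed

section \<open>Linear algebra of edge-indexed vectors\<close>

lemma mat_app_diff: "mat_app M (x - y) r = mat_app M x r - mat_app M y r"
  by (simp add: mat_app_def sum_subtractf algebra_simps)

lemma mat_app_scaleR: "mat_app M (a *\<^sub>R x) r = a * mat_app M x r"
  by (simp add: mat_app_def sum_distrib_left algebra_simps)

lemma mat_app_sum: "mat_app M (\<Sum>i\<in>I. x i) r = (\<Sum>i\<in>I. mat_app M (x i) r)"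
  unfolding mat_app_def by (simp add: sum_distrib_left) (rule sum.swap)

lemma transpose_app_inner: "transpose_app R M w \<bullet> v = inner_on R w (mat_app M v)"
  unfolding transpose_app_def inner_on_def mat_app_def inner_vec_def
  by (simp add: sum_distrib_left sum_distrib_right mult_ac) (rule sum.swap)

lemma gram_mult: "gram R M *v v = transpose_app R M (mat_app M v)"
  unfolding gram_def transpose_app_def mat_app_def matrix_vector_mult_def vec_eq_iff
  by (simp add: sum_distrib_left sum_distrib_right mult_ac) (intro allI sum.swap)

lemma transpose_gram: "transpose (gram R M) = gram R M"
  by (simp add: transpose_def gram_def vec_eq_iff mult.commute)

lemma inner_on_add_left: "inner_on R (\<lambda>r. x r + y r) z = inner_on R x z + inner_on R y z"
  by (simp add: inner_on_def sum.distrib algebra_simps)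

lemma inner_on_diff_left: "inner_on R (\<lambda>r. x r - y r) z = inner_on R x z - inner_on R y z"
  by (simp add: inner_on_def sum_subtractf algebra_simps)

lemma inner_on_scale_left: "inner_on R (\<lambda>r. a * x r) z = a * inner_on R x z"
  by (simp add: inner_on_def sum_distrib_left algebra_simps)

lemma inner_on_self_nonneg: "inner_on R x x \<ge> 0"
  by (simp add: inner_on_def sum_nonneg)

lemma norm_on_nonneg: "norm_on R x \<ge> 0"
  by (simp add: norm_on_def L2_set_nonneg)

lemma norm_on_power2: "(norm_on R x)\<^sup>2 = inner_on R x x"
  by (simp add: norm_on_def L2_set_def inner_on_def power2_eq_square sum_nonneg)

lemma norm_on_scale: "norm_on R (\<lambda>r. a * x r) = \<bar>a\<bar> * norm_on R x"
  unfolding norm_on_def L2_set_def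
  by (simp add: power_mult_distrib sum_distrib_left[symmetric] real_sqrt_mult)

lemma inner_on_le_norm: "\<bar>inner_on R x y\<bar> \<le> norm_on R x * norm_on R y"
proof -
  have "\<bar>inner_on R x y\<bar> \<le> (\<Sum>r\<in>R. \<bar>x r\<bar> * \<bar>y r\<bar>)"
    unfolding inner_on_def abs_mult[symmetric] by (rule sum_abs)
  also have "\<dots> \<le> norm_on R x * norm_on R y"
    unfolding norm_on_def by (rule L2_set_mult_ineq)
  finally show ?thesis .
qed

lemma inner_on_cong:
  assumes "\<And>r. r \<in> R \<Longrightarrow> x r = x' r" "\<And>r. r \<in> R \<Longrightarrow> y r = y' r"
  shows "inner_on R x y = inner_on R x' y'"
  unfolding inner_on_def using assms by (intro sum.cong) auto

text \<open>Polarisation, which turns the inner products of the iteration into differences of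
  squares that telescope.\<close>

lemma inner_on_three_point:
  "2 * inner_on R (\<lambda>r. x r - y r) (\<lambda>r. x r - z r) =
    inner_on R (\<lambda>r. x r - y r) (\<lambda>r. x r - y r) + inner_on R (\<lambda>r. x r - z r) (\<lambda>r. x r - z r)
    - inner_on R (\<lambda>r. y r - z r) (\<lambda>r. y r - z r)"
  unfolding inner_on_def sum_distrib_left sum.distrib[symmetric] sum_subtractf[symmetric]
  by (intro sum.cong) (auto simp: algebra_simps)

lemma inner_three_point:
  fixes x y z :: "'a::real_inner"
  shows "2 * ((x - y) \<bullet> (x - z)) = (x - y) \<bullet> (x - y) + (x - z) \<bullet> (x - z) - (y - z) \<bullet> (y - z)"
  by (simp add: inner_simps inner_commute)

section \<open>The ergodic rate\<close>

text \<open>One run of the algorithm relative to a feasible reference point \<open>l'\<close> at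
  which \<open>Q\<close> is finite. The real values \<open>q\<close> are tied to \<open>Q\<close>
  from index 1 on, since the arbitrary initial point may lie outside the domain of
  \<open>Q\<close>.\<close>

locale ddpg =
  fixes R :: "'r set" and M :: "'r \<Rightarrow> 'c::finite \<Rightarrow> real"
    and p :: "real^'c \<Rightarrow> real" and G :: "real^'c \<Rightarrow> real^'c" and Q :: "real^'c \<Rightarrow> ereal"
    and h c \<gamma> :: real
    and lam :: "nat \<Rightarrow> real^'c" and xi :: "nat \<Rightarrow> 'r \<Rightarrow> real" and q :: "nat \<Rightarrow> real"
    and l' :: "real^'c" and q' :: real
  assumes p_lower: "p x + G x \<bullet> (y - x) \<le> p y"
    and p_upper: "p y \<le> p x + G x \<bullet> (y - x) + h / 2 * (norm (y - x))\<^sup>2"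
    and step_size: "h * (v \<bullet> v) + \<gamma> * inner_on R (mat_app M v) (mat_app M v) \<le> (v \<bullet> v) / c"
    and h: "h \<ge> 0" and \<gamma>: "\<gamma> > 0" and c: "c > 0"
    and prox: "ereal (q (Suc t) + (1 / c) *
        ((lam t - c *\<^sub>R (G (lam t) + transpose_app R M (xi t) + \<gamma> *\<^sub>R (gram R M *v lam t)) - lam (Suc t))
          \<bullet> (x - lam (Suc t)))) \<le> Q x"
    and q: "Q (lam (Suc t)) = ereal (q (Suc t))"
    and xi: "r \<in> R \<Longrightarrow> xi (Suc t) r = xi t r + \<gamma> * mat_app M (lam (Suc t)) r"
    and q': "Q l' = ereal q'"
    and feasible: "r \<in> R \<Longrightarrow> mat_app M l' r = 0"
begin

text \<open>The squared norm of the proximal metric; \<gamma> is subtracted because the augmentation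
  term is evaluated at the old iterate.\<close>

definition D :: "real^'c \<Rightarrow> real" where
  "D v = (v \<bullet> v) / c - \<gamma> * inner_on R (mat_app M v) (mat_app M v)"

definition energy :: "('r \<Rightarrow> real) \<Rightarrow> nat \<Rightarrow> real" where
  "energy \<xi> t = D (lam t - l') / 2 + inner_on R (\<lambda>r. xi t r - \<xi> r) (\<lambda>r. xi t r - \<xi> r) / (2 * \<gamma>)"

lemma D_ge: "h * (v \<bullet> v) \<le> D v"
  using step_size[of v] by (simp add: D_def)

lemma D_nonneg: "0 \<le> D v"
proof -
  have "0 \<le> h * (v \<bullet> v)" using h by simp
  then show ?thesis using D_ge[of v] by linarith
qed

lemma energy_nonneg: "0 \<le> energy \<xi> t"
  unfolding energy_def using D_nonneg \<gamma> by (simp add: inner_on_self_nonneg)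

text \<open>Convexity and smoothness of \<open>p\<close> are both used at \<open>lam t\<close>, and
  the proximal inequality is tested at \<open>l'\<close>; the gradient terms then cancel.
  Three-point identities turn the rest into energies.\<close>

lemma descent:
  "p (lam (Suc t)) + q (Suc t) - (p l' + q') + inner_on R \<xi> (mat_app M (lam (Suc t)))
    \<le> energy \<xi> t - energy \<xi> (Suc t)"
proof -
  let ?l = "lam t" and ?n = "lam (Suc t)"
  let ?B = "\<lambda>x y. inner_on R (mat_app M x) (mat_app M y)"
  define d where "d = ?n - ?l"
  define e where "e = ?n - l'"
  have p: "p ?n \<le> p l' + G ?l \<bullet> e + h / 2 * (d \<bullet> d)"
    using p_lower[of ?l l'] p_upper[of ?n ?l]
    by (simp add: d_def e_def inner_diff_right power2_norm_eq_inner)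
  have "q (Suc t) + (1 / c) * ((?l - c *\<^sub>R (G ?l + transpose_app R M (xi t) + \<gamma> *\<^sub>R (gram R M *v ?l)) - ?n)
      \<bullet> (l' - ?n)) \<le> q'"
    using prox[of t l'] q' by simp
  also have "(?l - c *\<^sub>R (G ?l + transpose_app R M (xi t) + \<gamma> *\<^sub>R (gram R M *v ?l)) - ?n) \<bullet> (l' - ?n) =
      d \<bullet> e + c * (G ?l \<bullet> e + inner_on R (xi t) (mat_app M e) + \<gamma> * ?B ?l e)"
  proof -
    have "?l - c *\<^sub>R w - ?n = - (d + c *\<^sub>R w)" "l' - ?n = - e" for w
      by (simp_all add: d_def e_def)
    then show ?thesis
      by (simp only: inner_minus_left inner_minus_right minus_minus inner_add_left inner_scaleR_left
          transpose_app_inner gram_mult)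
  qed
  also have "(1 / c) * \<dots> = (1 / c) * (d \<bullet> e) + (G ?l \<bullet> e + inner_on R (xi t) (mat_app M e) + \<gamma> * ?B ?l e)"
    using c by (simp add: field_simps)
  finally have q: "q (Suc t) \<le> q' - (1 / c) * (d \<bullet> e) - G ?l \<bullet> e - inner_on R (xi t) (mat_app M e) - \<gamma> * ?B ?l e"
    by linarith
  \<comment> \<open>The new multiplier carries the augmentation term at the new iterate. Its
    mismatch with the old one is the form \<open>?B d e\<close>, which joins
    \<open>d \<bullet> e\<close> in the metric \<open>D\<close>.\<close>
  have xi_n: "inner_on R (xi (Suc t)) (mat_app M e) = inner_on R (xi t) (mat_app M e) + \<gamma> * ?B ?n e"
    by (subst inner_on_cong[OF xi refl], assumption) (simp add: inner_on_add_left inner_on_scale_left)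
  have B_d: "?B d e = ?B ?n e - ?B ?l e"
    by (simp add: d_def mat_app_diff[abs_def] inner_on_diff_left)
  have M_e: "inner_on R x (mat_app M e) = inner_on R x (mat_app M ?n)" for x
    by (intro inner_on_cong) (simp_all add: e_def mat_app_diff feasible)
  have "p ?n + q (Suc t) - (p l' + q') \<le> h / 2 * (d \<bullet> d) - (1 / c) * (d \<bullet> e) + \<gamma> * ?B d e
      - inner_on R (xi (Suc t)) (mat_app M ?n)"
    using p q by (simp add: M_e[symmetric] xi_n B_d right_diff_distrib)
  moreover have "(1 / c) * (d \<bullet> e) - \<gamma> * ?B d e = D d / 2 + D e / 2 - D (?l - l') / 2"
  proof -
    have "2 * (d \<bullet> e) = d \<bullet> d + e \<bullet> e - (?l - l') \<bullet> (?l - l')"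
      unfolding d_def e_def by (rule inner_three_point)
    moreover have "2 * ?B d e = ?B d d + ?B e e - ?B (?l - l') (?l - l')"
      unfolding d_def e_def mat_app_diff[abs_def] by (rule inner_on_three_point)
    moreover have "(1 / c) * (d \<bullet> e) - \<gamma> * ?B d e = (2 * (d \<bullet> e)) / c / 2 - \<gamma> * (2 * ?B d e) / 2"
      by simp
    ultimately show ?thesis
      unfolding D_def by (simp only:) (simp add: add_divide_distrib diff_divide_distrib algebra_simps)
  qed
  \<comment> \<open>The step size rule enters here: the smoothness error is absorbed by the term of
    \<open>D\<close> for the step \<open>d\<close>.\<close>
  moreover have "h / 2 * (d \<bullet> d) \<le> D d / 2"
    using D_ge[of d] by simp
  moreover have "inner_on R \<xi> (mat_app M ?n) - inner_on R (xi (Suc t)) (mat_app M ?n) \<le>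
      inner_on R (\<lambda>r. xi t r - \<xi> r) (\<lambda>r. xi t r - \<xi> r) / (2 * \<gamma>) -
      inner_on R (\<lambda>r. xi (Suc t) r - \<xi> r) (\<lambda>r. xi (Suc t) r - \<xi> r) / (2 * \<gamma>)"
  proof -
    have M_n: "inner_on R x (mat_app M ?n) = inner_on R (\<lambda>r. xi (Suc t) r - xi t r) x / \<gamma>" for x
      using \<gamma> unfolding inner_on_def sum_divide_distrib
      by (intro sum.cong) (simp_all add: xi)
    have "inner_on R (xi (Suc t)) (mat_app M ?n) - inner_on R \<xi> (mat_app M ?n) =
        inner_on R (\<lambda>r. xi (Suc t) r - \<xi> r) (mat_app M ?n)"
      by (simp add: inner_on_diff_left)
    also have "\<dots> = 2 * inner_on R (\<lambda>r. xi (Suc t) r - xi t r) (\<lambda>r. xi (Suc t) r - \<xi> r) / (2 * \<gamma>)"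
      unfolding M_n by simp
    \<comment> \<open>By the three-point identity the difference is the square of the multiplier
      step, which is dropped.\<close>
    also have "\<dots> \<ge> (inner_on R (\<lambda>r. xi (Suc t) r - \<xi> r) (\<lambda>r. xi (Suc t) r - \<xi> r)
        - inner_on R (\<lambda>r. xi t r - \<xi> r) (\<lambda>r. xi t r - \<xi> r)) / (2 * \<gamma>)"
      unfolding inner_on_three_point using \<gamma> by (intro divide_right_mono) (simp_all add: inner_on_self_nonneg)
    finally show ?thesis by (simp add: diff_divide_distrib)
  qed
  ultimately show ?thesis
    unfolding energy_def e_def by linarith
qed

definition avg :: "nat \<Rightarrow> real^'c" where
  "avg T = (1 / real (T + 1)) *\<^sub>R (\<Sum>t=0..T. lam (t + 1))"

text \<open>Jensen's inequality and telescoping. The finite value \<open>qa\<close> is fixed before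
  \<xi>, so the bound holds for all multipliers at once.\<close>

lemma avg_bound:
  assumes "convex_fun Q" "\<And>x. Q x \<noteq> -\<infinity>"
  obtains qa where "Q (avg T) = ereal qa"
    "\<And>\<xi>. p (avg T) + qa - (p l' + q') + inner_on R \<xi> (mat_app M (avg T)) \<le> energy \<xi> 0 / real (T + 1)"
proof -
  have avg: "avg T = (\<Sum>t=0..T. (1 / real (T + 1)) *\<^sub>R lam (t + 1))"
    by (simp add: avg_def scaleR_sum_right)
  define qm where "qm = (\<Sum>t=0..T. (1 / real (T + 1)) *\<^sub>R q (t + 1))"
  \<comment> \<open>Jensen's inequality for \<open>Q\<close> is convexity of the epigraph, which
    also makes \<open>Q\<close> finite at the average.\<close>
  have "(\<Sum>t=0..T. (1 / real (T + 1)) *\<^sub>R (lam (t + 1), q (t + 1))) \<in> epi Q"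
    using assms(1) q by (intro convex_sum) (auto simp: convex_fun_def epi_def)
  also have "(\<Sum>t=0..T. (1 / real (T + 1)) *\<^sub>R (lam (t + 1), q (t + 1))) = (avg T, qm)"
    unfolding avg qm_def by (simp add: sum_prod)
  finally have "Q (avg T) \<le> ereal qm" by (simp add: epi_def)
  then obtain qa where qa: "Q (avg T) = ereal qa" "qa \<le> qm"
    using assms(2)[of "avg T"] by (cases "Q (avg T)") auto
  have pa: "p (avg T) \<le> (\<Sum>t=0..T. p (lam (t + 1))) / real (T + 1)"
  proof -
    \<comment> \<open>Tangents at the average: their linear terms sum to zero.\<close>
    have "(\<Sum>t=0..T. p (avg T) + G (avg T) \<bullet> (lam (t + 1) - avg T)) \<le> (\<Sum>t=0..T. p (lam (t + 1)))"
      by (intro sum_mono p_lower)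
    also have "(\<Sum>t=0..T. p (avg T) + G (avg T) \<bullet> (lam (t + 1) - avg T)) =
        real (T + 1) * p (avg T) + G (avg T) \<bullet> ((\<Sum>t=0..T. lam (t + 1)) - real (T + 1) *\<^sub>R avg T)"
      by (simp add: sum.distrib inner_diff_right inner_sum_right sum_subtractf)
    also have "real (T + 1) *\<^sub>R avg T = (\<Sum>t=0..T. lam (t + 1))"
      by (simp add: avg_def)
    finally show ?thesis by (simp add: pos_le_divide_eq mult.commute)
  qed
  have "p (avg T) + qa - (p l' + q') + inner_on R \<xi> (mat_app M (avg T)) \<le> energy \<xi> 0 / real (T + 1)" for \<xi>
  proof -
    have "(\<Sum>t=0..T. p (lam (t + 1)) + q (t + 1) - (p l' + q') + inner_on R \<xi> (mat_app M (lam (t + 1))))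
        \<le> (\<Sum>t=0..T. energy \<xi> t - energy \<xi> (Suc t))"
      using descent by (intro sum_mono) simp
    also have "\<dots> = energy \<xi> 0 - energy \<xi> (Suc T)"
      by (rule sum_telescope[of _ T, unfolded atMost_atLeast0])
    also have "\<dots> \<le> energy \<xi> 0"
      using energy_nonneg[of \<xi> "Suc T"] by simp
    finally have "(\<Sum>t=0..T. p (lam (t + 1))) + (\<Sum>t=0..T. q (t + 1)) - real (T + 1) * (p l' + q')
        + (\<Sum>t=0..T. inner_on R \<xi> (mat_app M (lam (t + 1)))) \<le> energy \<xi> 0"
      by (simp add: sum.distrib sum_subtractf)
    moreover have "(\<Sum>t=0..T. inner_on R \<xi> (mat_app M (lam (t + 1)))) = real (T + 1) * inner_on R \<xi> (mat_app M (avg T))"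
      unfolding avg_def inner_on_def sum_distrib_left
      by (subst sum.swap) (simp add: mat_app_scaleR mat_app_sum sum_distrib_left[symmetric])
    moreover have "(\<Sum>t=0..T. q (t + 1)) = real (T + 1) * qm"
      by (simp add: qm_def sum_divide_distrib[symmetric])
    moreover have "real (T + 1) * p (avg T) \<le> (\<Sum>t=0..T. p (lam (t + 1)))"
      using pa by (simp add: pos_le_divide_eq mult.commute)
    moreover have "real (T + 1) * qa \<le> real (T + 1) * qm"
      using qa(2) by (intro mult_left_mono) auto
    ultimately have "real (T + 1) * (p (avg T) + qa - (p l' + q') + inner_on R \<xi> (mat_app M (avg T))) \<le> energy \<xi> 0"
      unfolding distrib_left right_diff_distrib by linarith
    then show ?thesis by (simp add: pos_le_divide_eq mult.commute)
  qed
  with qa(1) show ?thesis using that by blast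
qed

text \<open>The bound must be uniform over a ball of multipliers, because the one used for the rate
  varies with \<open>T\<close>.\<close>

lemma energy_bound:
  assumes "norm_on R \<xi> \<le> \<rho>"
  shows "energy \<xi> 0 \<le> D (lam 0 - l') / 2 + ((norm_on R (xi 0))\<^sup>2 + \<rho>\<^sup>2) / \<gamma>"
proof -
  have "inner_on R (\<lambda>r. xi 0 r - \<xi> r) (\<lambda>r. xi 0 r - \<xi> r) \<le> 2 * (norm_on R (xi 0))\<^sup>2 + 2 * (norm_on R \<xi>)\<^sup>2"
    unfolding norm_on_power2 inner_on_def sum_distrib_left sum.distrib[symmetric]
  proof (rule sum_mono)
    fix r
    show "(xi 0 r - \<xi> r) * (xi 0 r - \<xi> r) \<le> 2 * (xi 0 r * xi 0 r) + 2 * (\<xi> r * \<xi> r)"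
      using zero_le_square[of "xi 0 r + \<xi> r"] by (simp add: algebra_simps)
  qed
  also have "(norm_on R \<xi>)\<^sup>2 \<le> \<rho>\<^sup>2"
    using assms norm_on_nonneg by (intro power_mono) auto
  finally have "inner_on R (\<lambda>r. xi 0 r - \<xi> r) (\<lambda>r. xi 0 r - \<xi> r) / (2 * \<gamma>) \<le>
      (2 * (norm_on R (xi 0))\<^sup>2 + 2 * \<rho>\<^sup>2) / (2 * \<gamma>)"
    using \<gamma> by (intro divide_right_mono) auto
  also have "\<dots> = ((norm_on R (xi 0))\<^sup>2 + \<rho>\<^sup>2) / \<gamma>"
    using \<gamma> by (simp add: field_simps)
  finally show ?thesis by (simp add: energy_def)
qed

text \<open>With \<open>F\<close> the objective gap and \<open>a\<close> the norm of the constraint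
  residual at the average, the multiplier bound reads
  \<open>F + (N + 1) * a \<le> \<Theta>0 / T\<close> and the saddle point gives
  \<open>- (N * a) \<le> F\<close>. Adding them bounds \<open>a\<close>, and then \<open>F\<close>
  from both sides.\<close>

lemma ergodic_rate:
  assumes Q: "convex_fun Q" "\<And>x. Q x \<noteq> -\<infinity>"
    and saddle: "\<And>l. ereal (p l' + q') \<le> ereal (p l + inner_on R \<xi>' (mat_app M l)) + Q l"
  shows "\<exists>\<Theta>\<ge>0. \<forall>T::nat. T \<ge> 1 \<longrightarrow>
      \<bar>(ereal (p (avg T)) + Q (avg T)) - (ereal (p l') + Q l')\<bar> \<le> ereal (\<Theta> / real T) \<and>
      norm_on R \<xi>' * norm_on R (mat_app M (avg T)) \<le> \<Theta> / real T"
proof -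
  define N where "N = norm_on R \<xi>'"
  \<comment> \<open>The extra 1 leaves one copy of \<open>a\<close> after the saddle point bound has
    used up \<open>N * a\<close>.\<close>
  define \<rho> where "\<rho> = N + 1"
  define \<Theta>0 where "\<Theta>0 = D (lam 0 - l') / 2 + ((norm_on R (xi 0))\<^sup>2 + \<rho>\<^sup>2) / \<gamma>"
  \<comment> \<open>The factor \<open>N + 1\<close> dominates both 1, for the upper bound on
    \<open>F\<close>, and \<open>N\<close>, for the weighted residual and the lower bound.\<close>
  define \<Theta> where "\<Theta> = \<rho> * \<Theta>0"
  have N: "N \<ge> 0" by (simp add: N_def norm_on_nonneg)
  have \<Theta>0: "\<Theta>0 \<ge> 0" unfolding \<Theta>0_def using D_nonneg \<gamma> by simp
  have "\<Theta>0 \<le> \<Theta>" "N * \<Theta>0 \<le> \<Theta>" "\<Theta> \<ge> 0"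
    unfolding \<Theta>_def \<rho>_def using N \<Theta>0 by (simp_all add: algebra_simps)
  show ?thesis
  proof (intro exI[of _ \<Theta>] conjI allI impI)
    fix T :: nat assume T: "T \<ge> 1"
    obtain qa where qa: "Q (avg T) = ereal qa"
      and bound: "\<And>\<xi>. p (avg T) + qa - (p l' + q') + inner_on R \<xi> (mat_app M (avg T)) \<le> energy \<xi> 0 / real (T + 1)"
      using avg_bound[OF Q] by metis
    define F where "F = p (avg T) + qa - (p l' + q')"
    define y where "y = mat_app M (avg T)"
    define a where "a = norm_on R y"
    have a: "a \<ge> 0" by (simp add: a_def norm_on_nonneg)
    define \<xi> where "\<xi> = (\<lambda>r. \<rho> / a * y r)"
    \<comment> \<open>If \<open>a = 0\<close>, then \<open>\<xi> = 0\<close>, since \<open>\<rho> / 0 = 0\<close>, and both claims still hold.\<close>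
    have "norm_on R \<xi> \<le> \<rho>"
      unfolding \<xi>_def norm_on_scale a_def[symmetric] using a N by (simp add: \<rho>_def)
    then have "energy \<xi> 0 / real (T + 1) \<le> \<Theta>0 / real (T + 1)"
      unfolding \<Theta>0_def by (intro divide_right_mono energy_bound) auto
    also have "\<dots> \<le> \<Theta>0 / real T"
      using \<Theta>0 T by (intro divide_left_mono) auto
    finally have "F + inner_on R \<xi> y \<le> \<Theta>0 / real T"
      using bound[of \<xi>] by (simp add: F_def y_def)
    moreover have "inner_on R \<xi> y = \<rho> * a"
      unfolding \<xi>_def inner_on_scale_left norm_on_power2[symmetric] a_def[symmetric]
      by (simp add: power2_eq_square)
    ultimately have upper: "F + (N + 1) * a \<le> \<Theta>0 / real T"
      by (simp add: \<rho>_def)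
    have "ereal (p l' + q') \<le> ereal (p (avg T) + inner_on R \<xi>' y) + ereal qa"
      using saddle[of "avg T"] qa by (simp add: y_def)
    then have lower: "- (N * a) \<le> F"
      using inner_on_le_norm[of R \<xi>' y] by (simp add: F_def N_def a_def)
    have "a \<le> \<Theta>0 / real T"
      using upper lower by (simp add: algebra_simps)
    then have "N * a \<le> N * \<Theta>0 / real T"
      using N mult_left_mono by fastforce
    also have "\<dots> \<le> \<Theta> / real T"
      using \<open>N * \<Theta>0 \<le> \<Theta>\<close> by (intro divide_right_mono) auto
    finally have Na: "N * a \<le> \<Theta> / real T" .
    have "F \<le> \<Theta>0 / real T"
      using upper N a mult_nonneg_nonneg[of "N + 1" a] by linarith
    also have "\<dots> \<le> \<Theta> / real T"
      using \<open>\<Theta>0 \<le> \<Theta>\<close> by (intro divide_right_mono) auto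
    finally have "\<bar>F\<bar> \<le> \<Theta> / real T"
      using lower Na by linarith
    then show "\<bar>(ereal (p (avg T)) + Q (avg T)) - (ereal (p l') + Q l')\<bar> \<le> ereal (\<Theta> / real T)"
      by (simp add: qa q' F_def)
    show "norm_on R \<xi>' * norm_on R (mat_app M (avg T)) \<le> \<Theta> / real T"
      using Na by (simp add: N_def a_def y_def)
  qed fact
qed

end

section \<open>The rate for the dual problem\<close>

theorem theorem2:
  fixes E :: "'n::{finite,linorder} set set"
    and f g :: "'n \<Rightarrow> real^'m \<Rightarrow> ereal"
    and X :: "'n \<Rightarrow> (real^'m) set"
    and A :: "'n \<Rightarrow> real^'m^'b" and b :: "real^'b"
    and \<sigma> \<kappa> :: "'n \<Rightarrow> real" and c \<gamma> h :: real
    and P Q \<Phi> :: "real^('n \<times> ('b + 'm)) \<Rightarrow> ereal"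
    and M :: "nat \<times> 'b \<Rightarrow> 'n \<times> ('b + 'm) \<Rightarrow> real" and R :: "(nat \<times> 'b) set"
    and lam :: "nat \<Rightarrow> real^('n \<times> ('b + 'm))" and xi :: "nat \<Rightarrow> nat \<times> 'b \<Rightarrow> real"
    and avg :: "nat \<Rightarrow> real^('n \<times> ('b + 'm))"
    and lam_star :: "real^('n \<times> ('b + 'm))" and xi_star :: "nat \<times> 'b \<Rightarrow> real"
  defines "P \<equiv> P_fun f A b \<kappa>"
    and "Q \<equiv> Q_fun g X"
    and "\<Phi> \<equiv> (\<lambda>l. P l + Q l)"
    and "M \<equiv> M_mat E"
    and "R \<equiv> M_rows E"
    and "h \<equiv> Max (range (\<lambda>i. (spectral_norm (H_mat (A i)))\<^sup>2 / \<sigma> i))"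
    and "avg \<equiv> (\<lambda>T. (1 / real (T + 1)) *\<^sub>R (\<Sum>t=0..T. lam (t + 1)))"
  assumes graph: "undirected_graph E" "connected_graph E"
    and f: "\<And>i. proper_fun (f i)" "\<And>i. convex_fun (f i)" "\<And>i. closed_fun (f i)"
      "\<And>i. differentiable_fun (f i)" "\<And>i. \<sigma> i > 0" "\<And>i. strongly_convex_fun (\<sigma> i) (f i)"
    and g: "\<And>i. proper_fun (g i)" "\<And>i. convex_fun (g i)" "\<And>i. closed_fun (g i)"
    and X: "\<And>i. X i \<noteq> {}" "\<And>i. convex (X i)" "\<And>i. closed (X i)"
    and gX: "\<And>i. proper_fun (\<lambda>x. g i x + indicator_fun (X i) x)"
    and slater: "\<exists>x \<in> rel_interior (product_set X). block_row A *v x = b"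
    and kappa: "(\<Sum>i\<in>UNIV. \<kappa> i) = 1"
    and steps: "c > 0" "\<gamma> > 0" "inverse c \<ge> h + \<gamma> * max_eigenvalue (gram R M)"
    and lam_step: "\<And>t. lam (t + 1) = prox c Q (lam t - c *\<^sub>R
        (gradient P (lam t) + transpose_app R M (xi t) + \<gamma> *\<^sub>R (gram R M *v lam t)))"
    and xi_step: "\<And>t r. r \<in> R \<Longrightarrow> xi (t + 1) r = xi t r + \<gamma> * mat_app M (lam (t + 1)) r"
    and saddle: "(lam_star, xi_star) \<in> saddle_points (lagrangian E P Q)"
  shows "\<exists>\<Theta>\<ge>0. \<forall>T::nat. T \<ge> 1 \<longrightarrow>
      \<bar>\<Phi> (avg T) - \<Phi> lam_star\<bar> \<le> ereal (\<Theta> / real T) \<and>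
      norm_on R xi_star * norm_on R (mat_app M (avg T)) \<le> \<Theta> / real T"
proof -
  have finR: "finite R"
    by (simp add: R_def M_rows_def)
  obtain p where P: "\<And>l. P l = ereal (p l)"
    and p_lower: "\<And>l l'. p l + gradient P l \<bullet> (l' - l) \<le> p l'"
    and p_upper: "\<And>l l'. p l' \<le> p l + gradient P l \<bullet> (l' - l) + h / 2 * (norm (l' - l))\<^sup>2"
    unfolding P_def h_def by (rule P_fun_smooth[where f = f and \<sigma> = \<sigma> and A = A and b = b and \<kappa> = \<kappa>,
        OF f(1,3,6,5)]) blast
  have Q: "proper_fun Q" "closed_fun Q" "strongly_convex_fun 0 Q"
    unfolding Q_def by (rule Q_fun_closed_convex_proper[OF g X(2,3) gX])+
  have fin: "Q l \<noteq> -\<infinity>" for l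
    using Q(1) by (simp add: proper_fun_def)
  have sp: "lagrangian E P Q lam_star xi_star \<le> lagrangian E P Q l xi_star"
    "lagrangian E P Q lam_star \<xi> \<le> lagrangian E P Q lam_star xi_star" for l \<xi>
    using saddle unfolding saddle_points_def by blast+
  have L: "lagrangian E P Q l \<xi> = ereal (p l + inner_on R \<xi> (mat_app M l)) + Q l" for l \<xi>
    by (cases "Q l") (simp_all add: lagrangian_def P R_def M_def)
  obtain l0 where "Q l0 \<noteq> \<infinity>"
    using Q(1) by (auto simp: proper_fun_def)
  \<comment> \<open>Comparison with a point in the domain of \<open>Q\<close> shows that the saddle
    value is finite.\<close>
  then obtain q' where q': "Q lam_star = ereal q'"
    using sp(1)[of l0] fin[of lam_star] fin[of l0] unfolding L
    by (cases "Q lam_star"; cases "Q l0") auto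
  have feasible: "mat_app M lam_star r = 0" if "r \<in> R" for r
  proof -
    let ?m = "mat_app M lam_star"
    \<comment> \<open>Moving the multiplier by the residual itself cannot increase the Lagrangian,
      so the squared residual is at most zero.\<close>
    have "inner_on R (\<lambda>r. xi_star r + ?m r) ?m \<le> inner_on R xi_star ?m"
      using sp(2)[of "\<lambda>r. xi_star r + ?m r"] by (simp add: L q')
    then have "(\<Sum>r\<in>R. ?m r * ?m r) \<le> 0"
      unfolding inner_on_add_left by (simp add: inner_on_def)
    then have "(\<Sum>r\<in>R. ?m r * ?m r) = 0"
      by (intro antisym sum_nonneg) auto
    then show ?thesis
      using finR that by (subst (asm) sum_nonneg_eq_0_iff) auto
  qed
  have h_nonneg: "h \<ge> 0"
  proof -
    \<comment> \<open>Any vertex will do: the vertex type is non-empty, and the maximum dominates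
      its nonnegative term.\<close>
    fix i
    have "0 \<le> (spectral_norm (H_mat (A i)))\<^sup>2 / \<sigma> i"
      using f(5)[of i] by simp
    also have "\<dots> \<le> h"
      unfolding h_def by (rule Max_ge) auto
    finally show ?thesis .
  qed
  have step_size: "h * (v \<bullet> v) + \<gamma> * inner_on R (mat_app M v) (mat_app M v) \<le> (v \<bullet> v) / c" for v
  proof -
    have "inner_on R (mat_app M v) (mat_app M v) \<le> max_eigenvalue (gram R M) * (v \<bullet> v)"
      using rayleigh_le_max_eigenvalue[OF transpose_gram, of v R M]
      by (metis gram_mult transpose_app_inner inner_commute)
    then have "h * (v \<bullet> v) + \<gamma> * inner_on R (mat_app M v) (mat_app M v) \<le>
        (h + \<gamma> * max_eigenvalue (gram R M)) * (v \<bullet> v)"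
      using steps(2) by (simp add: distrib_right mult.assoc)
    also have "\<dots> \<le> inverse c * (v \<bullet> v)"
      using steps(3) by (intro mult_right_mono) auto
    finally show ?thesis by (simp add: divide_inverse mult.commute)
  qed
  \<comment> \<open>At \<open>t = 0\<close> the value of \<open>Q\<close> may be infinite, where
    \<open>real_of_ereal\<close> returns 0; the facts below concern \<open>Suc t\<close>
    only.\<close>
  define q where "q t = real_of_ereal (Q (lam t))" for t
  have prox: "Q (lam (Suc t)) = ereal (q (Suc t))"
    "ereal (q (Suc t) + (1 / c) * ((lam t - c *\<^sub>R (gradient P (lam t) + transpose_app R M (xi t)
      + \<gamma> *\<^sub>R (gram R M *v lam t)) - lam (Suc t)) \<bullet> (x - lam (Suc t)))) \<le> Q x" for t x
  proof -
    let ?v = "lam t - c *\<^sub>R (gradient P (lam t) + transpose_app R M (xi t) + \<gamma> *\<^sub>R (gram R M *v lam t))"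
    have step: "prox c Q ?v = lam (Suc t)"
      using lam_step[of t] by simp
    obtain r where "Q (lam (Suc t)) = ereal r"
      "\<And>x. ereal (r + (1 / c) * ((?v - lam (Suc t)) \<bullet> (x - lam (Suc t)))) \<le> Q x"
      using prox_inequality[OF Q steps(1), of ?v, unfolded step] by blast
    then show "Q (lam (Suc t)) = ereal (q (Suc t))"
      "ereal (q (Suc t) + (1 / c) * ((lam t - c *\<^sub>R (gradient P (lam t) + transpose_app R M (xi t)
      + \<gamma> *\<^sub>R (gram R M *v lam t)) - lam (Suc t)) \<bullet> (x - lam (Suc t)))) \<le> Q x"
      by (simp_all add: q_def)
  qed
  interpret iteration: ddpg R M p "gradient P" Q h c \<gamma> lam xi q lam_star q'
    using p_lower p_upper step_size h_nonneg steps prox q' feasible xi_step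
    by unfold_locales simp_all
  have "convex_fun Q"
    using strongly_convex_imp_convex_fun[OF Q(3)] by simp
  moreover have "ereal (p lam_star + q') \<le> ereal (p l + inner_on R xi_star (mat_app M l)) + Q l" for l
  proof -
    \<comment> \<open>Feasibility removes the multiplier term, so the saddle value is the optimal
      dual objective.\<close>
    have "inner_on R xi_star (mat_app M lam_star) = 0"
      by (simp add: inner_on_def feasible)
    then show ?thesis using sp(1)[of l] by (simp add: L q')
  qed
  ultimately show ?thesis
    using iteration.ergodic_rate[OF _ fin, of xi_star]
    unfolding avg_def iteration.avg_def \<Phi>_def P by simp
qed

end
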